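(* Let $L$ be a finite semidistributive lattice. The following properties are equivalent: (i) $L$ is extremal. (ii) $L$ is left modular. (iii) $L$ is EL-shellable. (iv) $L$ is shellable.
   Context: All posets and lattices are finite, and lattices are nonempty. A poset $L$ is a lattice if every pair $\{x,y\}\subseteq L$ has a greatest lower bound (meet) $x\wedge y$ and a least upper bound (join) $x\vee y$. Semidistributivity. A lattice $L$ is join-semidistributive if, for all $x,y,z\in L$, the equality $x\vee y=x\vee z$ implies $x\vee(y\wedge z)=x\vee y$. Dually, $L$ is meet-semidistributive if, for all $x,y,z\in L$, the equality $x\wedge y=x\wedge z$ implies $x\wedge(y\vee z)=x\wedge y$. $L$ is semidistributive if it is both join-semidistributive and meet-semidistributive. Chains and covers. A chain of a poset is a totally ordered subset; it is maximal if it is not a proper subset of a larger chain. For $x,y$ in a poset, $y$ covers $x$, written $x\lessdot y$, if $x<y$ and there is no $z$ with $x<z<y$. Extremality. An element of $L$ is join-irreducible if it covers exactly one element, and meet-irreducible if it is covered by exactly one element; $\mathrm{JIrr}(L)$ and $\mathrm{MIrr}(L)$ denote the sets of join-irreducible and meet-irreducible elements of $L$. The length of a chain is its number of elements minus one, and $\ell(L)$ is the maximal length of a chain of $L$. The lattice $L$ is extremal if $\ell(L)=|\mathrm{JIrr}(L)|$ and $\ell(L)=|\mathrm{MIrr}(L)|$. Left modularity. An element $m\in L$ is left modular if, for every $x,y\in L$ with $x\leq y$, we have $x\vee(m\wedge y)=(x\vee m)\wedge y$. The lattice $L$ is left modular if it has a maximal chain consisting entirely of left-modular elements. EL-shellability.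 An edge-labeling of a poset assigns to each cover relation a label in a set. If the set of labels is totally ordered, such an edge-labeling is an EL-labeling if, in every interval $[x,y]$, there is a unique maximal chain whose labels (read from $x$ up to $y$) are strictly increasing, and its label sequence is lexicographically smallest among those of all maximal chains in $[x,y]$. A poset is EL-shellable if it admits an EL-labeling. Shellability. The order complex $\Delta(P)$ of a poset $P$ is the simplicial complex on vertex set $P$ whose faces are the chains of $P$; its facets are the maximal chains of $P$. A simplicial complex (not necessarily pure) is shellable if there is a linear order $F_1,F_2,\dots,F_k$ of its facets such that for all $1\leq i<j\leq k$ there exists $l<j$ with $F_i\cap F_j\subseteq F_l\cap F_j$ and $|F_l\cap F_j|=|F_j|-1$. A poset $P$ is shellable if $\Delta(P)$ is shellable. *)

theory Defs
  imports Main
begin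

definition join_semidistributive :: "'a::lattice itself \<Rightarrow> bool" where
  "join_semidistributive _ \<longleftrightarrow>
     (\<forall>x y z :: 'a. sup x y = sup x z \<longrightarrow> sup x (inf y z) = sup x y)"

definition meet_semidistributive :: "'a::lattice itself \<Rightarrow> bool" where
  "meet_semidistributive _ \<longleftrightarrow>
     (\<forall>x y z :: 'a. inf x y = inf x z \<longrightarrow> inf x (sup y z) = inf x y)"

definition semidistributive :: "'a::lattice itself \<Rightarrow> bool" where
  "semidistributive L \<longleftrightarrow> join_semidistributive L \<and> meet_semidistributive L"


definition covered_by :: "'a::order \<Rightarrow> 'a \<Rightarrow> bool" where
  "covered_by x y \<longleftrightarrow> x < y \<and> \<not> (\<exists>z. x < z \<and> z < y)"

text \<open>
  Chains and maximal chains of a subset \<open>A\<close> of a poset are those of \<^theory>\<open>HOL.Zorn\<close>;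
  there, the relation \<open>(<)\<close> is replaced by its reflexive closure.
\<close>

abbreviation chain_of :: "'a::order set \<Rightarrow> 'a set \<Rightarrow> bool" where
  "chain_of A C \<equiv> pred_on.chain A (<) C"

abbreviation maxchain_of :: "'a::order set \<Rightarrow> 'a set \<Rightarrow> bool" where
  "maxchain_of A C \<equiv> pred_on.maxchain A (<) C"


definition JIrr :: "'a::order set" where
  "JIrr = {x. \<exists>!y. covered_by y x}"

definition MIrr :: "'a::order set" where
  "MIrr = {x. \<exists>!y. covered_by x y}"

text \<open>The empty chain, which would have length \<open>-1\<close>, is left out.\<close>

definition lattice_length :: "'a::{finite,order} itself \<Rightarrow> nat" where
  "lattice_length _ = Max {card C - 1 | C :: 'a set. chain_of UNIV C \<and> C \<noteq> {}}"

definition extremal :: "'a::{finite,lattice} itself \<Rightarrow> bool" where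
  "extremal L \<longleftrightarrow>
     lattice_length L = card (JIrr :: 'a set) \<and> lattice_length L = card (MIrr :: 'a set)"


definition left_modular_element :: "'a::lattice \<Rightarrow> bool" where
  "left_modular_element m \<longleftrightarrow>
     (\<forall>x y. x \<le> y \<longrightarrow> sup x (inf m y) = inf (sup x m) y)"

definition left_modular :: "'a::{finite,lattice} itself \<Rightarrow> bool" where
  "left_modular _ \<longleftrightarrow>
     (\<exists>C :: 'a set. maxchain_of UNIV C \<and> (\<forall>m\<in>C. left_modular_element m))"


text \<open>A maximal chain of the interval \<open>[x, y]\<close>, listed from \<open>x\<close> up to \<open>y\<close>.\<close>

definition maxchain_list :: "'a::order \<Rightarrow> 'a \<Rightarrow> 'a list \<Rightarrow> bool" where
  "maxchain_list x y xs \<longleftrightarrow> sorted_wrt (<) xs \<and> maxchain_of {x..y} (set xs)"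

definition labels :: "('a \<Rightarrow> 'a \<Rightarrow> 'b) \<Rightarrow> 'a list \<Rightarrow> 'b list" where
  "labels lab xs = map2 lab xs (tl xs)"

text \<open>
  An edge-labeling is a function of two arguments \<open>x\<close>, \<open>y\<close> of which only the values with
  \<open>covered_by x y\<close> matter.
\<close>

definition EL_labeling :: "('a::{finite,order} \<Rightarrow> 'a \<Rightarrow> 'b::linorder) \<Rightarrow> bool" where
  "EL_labeling lab \<longleftrightarrow>
     (\<forall>x y. x \<le> y \<longrightarrow>
        (\<exists>!xs. maxchain_list x y xs \<and> sorted_wrt (<) (labels lab xs)) \<and>
        (\<forall>xs ys. maxchain_list x y xs \<longrightarrow> sorted_wrt (<) (labels lab xs) \<longrightarrow>
           maxchain_list x y ys \<longrightarrow> ord_class.lexordp_eq (labels lab xs) (labels lab ys)))"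

text \<open>
  Only finitely many labels occur, so natural numbers suffice as labels: see
  \<open>EL_labeling_imp_EL_shellable\<close> below for labels in an arbitrary linear order.
\<close>

definition EL_shellable :: "'a::{finite,order} itself \<Rightarrow> bool" where
  "EL_shellable _ \<longleftrightarrow> (\<exists>lab :: 'a \<Rightarrow> 'a \<Rightarrow> nat. EL_labeling lab)"

lemma labels_comp: "labels (\<lambda>x y. r (lab x y)) xs = map r (labels lab xs)"
  by (simp add: labels_def case_prod_beta comp_def)

lemma set_labels: "set (labels lab xs) \<subseteq> range (case_prod lab)"
  by (auto simp: labels_def)

lemma sorted_wrt_map_strict_mono_on:
  fixes r :: "'b::linorder \<Rightarrow> 'c::linorder"
  assumes "strict_mono_on S r" "set xs \<subseteq> S"
  shows "sorted_wrt (<) (map r xs) \<longleftrightarrow> sorted_wrt (<) xs"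
  using assms(2)
proof (induction xs)
  case (Cons a xs)
  have "r a < r b \<longleftrightarrow> a < b" if "b \<in> set xs" for b
    using assms(1) Cons.prems that by (auto simp: strict_mono_on_less subset_iff)
  then show ?case using Cons by auto
qed simp

lemma lexordp_eq_map_strict_mono_on:
  fixes r :: "'b::linorder \<Rightarrow> 'c::linorder"
  assumes "strict_mono_on S r" "set xs \<subseteq> S" "set ys \<subseteq> S"
  shows "ord_class.lexordp_eq (map r xs) (map r ys) \<longleftrightarrow> ord_class.lexordp_eq xs ys"
  using assms(2,3)
proof (induction xs arbitrary: ys)
  case (Cons a xs)
  then show ?case
    by (cases ys) (auto simp: strict_mono_on_less[OF assms(1)])
qed simp

theorem EL_labeling_imp_EL_shellable:
  fixes lab :: "'a::{finite,order} \<Rightarrow> 'a \<Rightarrow> 'b::linorder"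
  assumes "EL_labeling lab"
  shows "EL_shellable TYPE('a)"
proof -
  define S where "S = range (case_prod lab)"
  define r where "r = (\<lambda>v. card {l \<in> S. l < v})"
  have fin: "finite S" by (simp add: S_def)
  have r: "strict_mono_on S r"
    unfolding r_def by (rule strict_mono_onI, rule psubset_card_mono) (use fin in auto)
  have S: "set (labels lab xs) \<subseteq> S" for xs
    using set_labels unfolding S_def .
  have "EL_labeling (\<lambda>x y. r (lab x y))"
    using assms
    unfolding EL_labeling_def labels_comp
      sorted_wrt_map_strict_mono_on[OF r S] lexordp_eq_map_strict_mono_on[OF r S S] .
  then show ?thesis unfolding EL_shellable_def by blast
qed


text \<open>A simplicial complex is given by its set of faces, the empty face included.\<close>

definition order_complex :: "'a::order itself \<Rightarrow> 'a set set" where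
  "order_complex _ = {C. chain_of UNIV C}"

definition facets :: "'a set set \<Rightarrow> 'a set set" where
  "facets K = {F \<in> K. \<not> (\<exists>G\<in>K. F \<subset> G)}"

definition shellable_complex :: "'a set set \<Rightarrow> bool" where
  "shellable_complex K \<longleftrightarrow>
     (\<exists>F. distinct F \<and> set F = facets K \<and>
        (\<forall>i j. i < j \<and> j < length F \<longrightarrow>
           (\<exists>l<j. F ! i \<inter> F ! j \<subseteq> F ! l \<inter> F ! j \<and>
                  card (F ! l \<inter> F ! j) + 1 = card (F ! j))))"

definition shellable :: "'a::{finite,order} itself \<Rightarrow> bool" where
  "shellable P \<longleftrightarrow> shellable_complex (order_complex P)"

end

(*
Label a cover x < y of a semidistributive lattice by the join-irreducible j that is minimal with
j <= y and not j <= x; it is unique, and it determines y as the join of x and j. All four properties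
are compared with the existence of a full chain: a maximal chain on which every join-irreducible
occurs as a label. The labels along a chain are distinct, so a full chain is a chain of length
|JIrr|. Let kappa j be the largest z whose meet with j is the element covered by j. An element c of
a full chain satisfies j <= c or c <= kappa j for every j, so no cover has the same meets and the
same joins with c, which is left modularity; conversely, a left modular maximal chain is full.
The position of j along a full chain gives an EL-labeling, and the lexicographic order of the maximal chains is
a shelling. Finally, replacing one element of a maximal chain as in a shelling step loses no label, and each join-irreducible is a label of some maximal
chain; so the first facet of a shelling is full.
*)
theory Submission
  imports Defs
begin

section \<open>Covers and maximal chains\<close>

text \<open>The four properties concern different objects (a number, a chain, a labeling, an order
  of facets); fullness is a condition on one chain that can be tested label by label, which makes it
  the common term. The two halves of semidistributivity act separately: the join half makes the
  label of a cover unique, and the meet half says that the elements above everything strictly below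
  \<open>j\<close>, but not above \<open>j\<close>, are closed under joins. The second fact produces
  the increasing chains. In an interval from \<open>x\<close> to \<open>y\<close>, let
  \<open>j\<close> have least position in the full chain. A step from \<open>u\<close> inside the
  interval from \<open>x\<close> to \<open>sup x j\<close> with another label \<open>k\<close> would
  have a later position, so some \<open>a\<close> on the full chain is above \<open>j\<close> and
  below the kappa of \<open>k\<close>. So is \<open>u\<close>, hence \<open>sup u a\<close> is not
  above \<open>k\<close>, although \<open>k \<le> sup x j \<le> sup u a\<close>. Thus
  \<open>sup x j\<close> covers \<open>x\<close>. Nothing is graded: maximal chains may differ in
  length, and one element may be exchanged for several. For an arbitrary EL-labeling, distinct
  maximal chains may also carry the same label sequence.\<close>

lemma chain_of_iff: "chain_of A C \<longleftrightarrow> C \<subseteq> A \<and> (\<forall>x\<in>C. \<forall>y\<in>C. x \<le> y \<or> y \<le> x)"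
  by (auto simp: pred_on.chain_def order.order_iff_strict)

lemma maxchain_of_iff:
  "maxchain_of A C \<longleftrightarrow> chain_of A C \<and> (\<forall>z\<in>A. (\<forall>c\<in>C. c \<le> z \<or> z \<le> c) \<longrightarrow> z \<in> C)"
proof (intro iffI conjI ballI impI)
  assume C: "maxchain_of A C"
  then show "chain_of A C" by (simp add: pred_on.maxchain_def)
  fix z assume z: "z \<in> A" "\<forall>c\<in>C. c \<le> z \<or> z \<le> c"
  have "chain_of A (insert z C)"
    using \<open>chain_of A C\<close> z unfolding chain_of_iff by auto
  then show "z \<in> C" using C unfolding pred_on.maxchain_def by blast
next
  assume C: "chain_of A C \<and> (\<forall>z\<in>A. (\<forall>c\<in>C. c \<le> z \<or> z \<le> c) \<longrightarrow> z \<in> C)"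
  have "S \<subseteq> C" if "chain_of A S" "C \<subset> S" for S
    using that C unfolding chain_of_iff by blast
  then show "maxchain_of A C" using C unfolding pred_on.maxchain_def by blast
qed

lemma facets_order_complex:
  "facets (order_complex TYPE('a::order)) = {C :: 'a set. maxchain_of UNIV C}"
  unfolding facets_def order_complex_def pred_on.maxchain_def by blast

lemma maxchain_of_extend:
  fixes C :: "'a::{finite,order} set"
  assumes "chain_of UNIV C"
  obtains M where "maxchain_of UNIV M" "C \<subseteq> M"
proof -
  obtain M where M: "M \<in> Collect (chain_of UNIV)" "C \<subseteq> M"
    and max: "\<forall>D\<in>Collect (chain_of UNIV). M \<subseteq> D \<longrightarrow> M = D"
    using finite_has_maximal2[of "Collect (chain_of UNIV)" C] assms by (auto simp: finite_subset)
  have "maxchain_of UNIV M"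
    using M max unfolding pred_on.maxchain_def by blast
  then show thesis using M that by blast
qed

lemma covered_by_between: "covered_by x y \<Longrightarrow> x \<le> z \<Longrightarrow> z \<le> y \<Longrightarrow> z = x \<or> z = y"
  by (auto simp: covered_by_def order.order_iff_strict)

lemma covered_byD: "covered_by x y \<Longrightarrow> x < y"
  by (simp add: covered_by_def)

lemma upper_cover_below:
  fixes x y :: "'a::{finite,order}"
  assumes "x < y"
  obtains w where "covered_by x w" "w \<le> y"
proof -
  obtain w where w: "x < w" "w \<le> y" and min: "\<forall>b\<in>{x<..y}. b \<le> w \<longrightarrow> w = b"
    using finite_has_minimal2[of "{x<..y}" y] assms by auto
  have False if "x < z" "z < w" for z
    using min w that by (auto dest: bspec[of _ _ z])
  then show thesis using that w unfolding covered_by_def by blast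
qed

lemma lower_cover_above:
  fixes x y :: "'a::{finite,order}"
  assumes "x < y"
  obtains w where "x \<le> w" "covered_by w y"
proof -
  obtain w where w: "x \<le> w" "w < y" and max: "\<forall>b\<in>{x..<y}. w \<le> b \<longrightarrow> w = b"
    using finite_has_maximal2[of "{x..<y}" x] assms by auto
  have False if "w < z" "z < y" for z
    using max w that by (auto dest: bspec[of _ _ z])
  then show thesis using that w unfolding covered_by_def by blast
qed

text \<open>An up-closed property cuts the chain in two. An element strictly between the last member
  without \<open>P\<close> and the first member with \<open>P\<close> would be comparable with all
  of \<open>C\<close>, hence in \<open>C\<close> by maximality; so these two form a cover.\<close>

lemma maxchain_of_cross:
  fixes C :: "'a::{finite,order} set"
  assumes C: "maxchain_of UNIV C"
    and P: "\<And>x y. x \<le> y \<Longrightarrow> P x \<Longrightarrow> P y"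
    and ab: "a \<in> C" "\<not> P a" "b \<in> C" "P b"
  obtains s t where "s \<in> C" "t \<in> C" "covered_by s t" "\<not> P s" "P t"
proof -
  have chain: "\<And>x y. x \<in> C \<Longrightarrow> y \<in> C \<Longrightarrow> x \<le> y \<or> y \<le> x"
    and max: "\<And>z. (\<forall>c\<in>C. c \<le> z \<or> z \<le> c) \<Longrightarrow> z \<in> C"
    using C unfolding maxchain_of_iff chain_of_iff by auto
  obtain s where s: "s \<in> {c \<in> C. \<not> P c}" "\<forall>c\<in>{c \<in> C. \<not> P c}. s \<le> c \<longrightarrow> s = c"
    using finite_has_maximal2[of "{c \<in> C. \<not> P c}" a] ab by auto
  obtain t where t: "t \<in> {c \<in> C. P c}" "\<forall>c\<in>{c \<in> C. P c}. c \<le> t \<longrightarrow> t = c"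
    using finite_has_minimal2[of "{c \<in> C. P c}" b] ab by auto
  have st: "c \<le> s \<or> t \<le> c" if "c \<in> C" for c
    using that s t chain by (metis (mono_tags, lifting) mem_Collect_eq)
  have "s < t" using s t chain P by (metis (mono_tags, lifting) mem_Collect_eq order_le_less)
  moreover have False if "s < z" "z < t" for z
  proof -
    have "z \<in> C" using st that by (intro max) (meson less_imp_le order_trans)
    then show False using st that by (meson leD)
  qed
  ultimately have "covered_by s t" unfolding covered_by_def by blast
  then show thesis using that s t by blast
qed

lemma bounded_finite_lattice:
  obtains l u :: "'a::{finite,lattice}" where "\<And>x. l \<le> x" "\<And>x. x \<le> u"
  by (rule that[of "Inf_fin UNIV" "Sup_fin UNIV"])
     (auto intro: Inf_fin.coboundedI Sup_fin.coboundedI)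

section \<open>Maximal chains as lists of consecutive covers\<close>

lemma chain_of_sorted_list:
  fixes C :: "'a::{finite,order} set"
  assumes "chain_of UNIV C"
  obtains xs where "sorted_wrt (<) xs" "set xs = C"
proof -
  have "\<exists>xs. sorted_wrt (<) xs \<and> set xs = C"
    using finite[of C] assms
  proof (induction C rule: finite_psubset_induct)
    case (psubset C)
    show ?case
    proof (cases "C = {}")
      case False
      then obtain m where m: "m \<in> C" "\<forall>c\<in>C. c \<le> m \<longrightarrow> m = c"
        using finite_has_minimal[of C] by auto
      obtain xs where xs: "sorted_wrt (<) xs" "set xs = C - {m}"
        using psubset.IH[of "C - {m}"] psubset.prems m unfolding chain_of_iff by blast
      have "\<forall>c\<in>C - {m}. m < c"
        using m psubset.prems unfolding chain_of_iff by (metis DiffE insertI1 order_le_less)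
      then show ?thesis using xs m by (intro exI[of _ "m # xs"]) auto
    qed auto
  qed
  then show thesis using that by blast
qed

text \<open>A local form of maximality: only consecutive entries are compared, so chains can be cut,
  concatenated and treated by induction on the list, while the interval shrinks with the
  list.\<close>

definition saturated :: "'a::order \<Rightarrow> 'a \<Rightarrow> 'a list \<Rightarrow> bool" where
  "saturated x y xs \<longleftrightarrow> xs \<noteq> [] \<and> hd xs = x \<and> last xs = y \<and> successively covered_by xs"

lemma saturated_Cons:
  "saturated x y (a # xs) \<longleftrightarrow>
     a = x \<and> (if xs = [] then x = y else covered_by x (hd xs) \<and> saturated (hd xs) y xs)"
  by (auto simp: saturated_def successively_Cons)

lemma saturated_append:
  "saturated x y (as @ p # bs) \<longleftrightarrow> saturated x p (as @ [p]) \<and> saturated p y (p # bs)"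
  by (induction as arbitrary: x) (auto simp: saturated_Cons hd_append)

lemma saturated_sorted: "saturated x y xs \<Longrightarrow> sorted_wrt (<) xs"
proof -
  assume "saturated x y xs"
  then have "successively (<) xs"
    unfolding saturated_def by (auto elim: successively_mono dest: covered_byD)
  then show ?thesis by (simp add: successively_conv_sorted_wrt)
qed

lemma saturated_bounds: "saturated x y xs \<Longrightarrow> z \<in> set xs \<Longrightarrow> x \<le> z \<and> z \<le> y"
proof (induction xs arbitrary: x z)
  case (Cons a xs)
  show ?case
  proof (cases "xs = []")
    case False
    then have "x < hd xs" "saturated (hd xs) y xs"
      using Cons.prems by (auto simp: saturated_Cons dest: covered_byD)
    then have "\<forall>z\<in>set xs. hd xs \<le> z \<and> z \<le> y" "hd xs \<in> set xs"
      using Cons.IH False by auto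
    then show ?thesis using Cons.prems \<open>x < hd xs\<close>
      by (auto simp: saturated_Cons)
  qed (use Cons.prems in \<open>auto simp: saturated_Cons\<close>)
qed (simp add: saturated_def)

lemma saturated_le: "saturated x y xs \<Longrightarrow> x \<le> y"
  using saturated_bounds[of x y xs y] by (auto simp: saturated_def)

lemma saturated_self: "saturated x x xs \<longleftrightarrow> xs = [x]"
proof
  assume xs: "saturated x x xs"
  then obtain ys where ys: "xs = x # ys" by (cases xs) (auto simp: saturated_def)
  have "ys = []"
  proof (rule ccontr)
    assume "ys \<noteq> []"
    then have "x < hd ys" "hd ys \<le> x"
      using xs saturated_le by (auto simp: ys saturated_Cons dest: covered_byD)
    then show False by simp
  qed
  then show "xs = [x]" using ys by simp
qed (simp add: saturated_Cons)

lemma saturated_ConsE: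
  assumes "saturated x y xs" "x < y"
  obtains ys where "xs = x # ys" "ys \<noteq> []" "covered_by x (hd ys)" "saturated (hd ys) y ys"
proof (cases xs)
  case Nil
  then show thesis using assms by (simp add: saturated_def)
next
  case (Cons a ys)
  then show thesis using assms that[of ys] by (auto simp: saturated_Cons split: if_splits)
qed

lemma saturated_covered:
  assumes c: "covered_by x y" and xs: "saturated x y xs"
  shows "xs = [x, y]"
proof -
  obtain ys where ys: "xs = x # ys" "ys \<noteq> []" "covered_by x (hd ys)" "saturated (hd ys) y ys"
    using saturated_ConsE[OF xs covered_byD[OF c]] .
  have "x < hd ys" "hd ys \<le> y" using ys(3,4) by (auto dest: covered_byD saturated_le)
  then have "hd ys = y" using covered_by_between[OF c, of "hd ys"] by (auto simp: less_imp_le)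
  then show "xs = [x, y]" using ys by (simp add: saturated_self)
qed

lemma saturated_maximal:
  "saturated x y xs \<Longrightarrow> x \<le> z \<Longrightarrow> z \<le> y \<Longrightarrow> \<forall>c\<in>set xs. c \<le> z \<or> z \<le> c \<Longrightarrow> z \<in> set xs"
proof (induction xs arbitrary: x)
  case (Cons a xs)
  show ?case
  proof (cases "xs = [] \<or> z = x")
    case False
    then have c: "covered_by x (hd xs)" "saturated (hd xs) y xs" and "hd xs \<in> set xs"
      using Cons.prems by (auto simp: saturated_Cons)
    then have "hd xs \<le> z"
      using covered_by_between[OF c(1), of z] Cons.prems False by auto
    then show ?thesis using Cons.IH[OF c(2)] Cons.prems by auto
  qed (use Cons.prems in \<open>auto simp: saturated_Cons\<close>)
qed (simp add: saturated_def)

lemma not_successively_split: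
  "\<not> successively P xs \<Longrightarrow> \<exists>as p q bs. xs = as @ p # q # bs \<and> \<not> P p q"
proof (induction xs)
  case (Cons a xs)
  show ?case
  proof (cases "successively P xs")
    case True
    then show ?thesis using Cons.prems
      by (intro exI[of _ "[]"] exI[of _ a] exI[of _ "hd xs"] exI[of _ "tl xs"])
         (auto simp: successively_Cons)
  next
    case False
    then obtain as p q bs where "xs = as @ p # q # bs" "\<not> P p q"
      using Cons.IH by blast
    then show ?thesis by (intro exI[of _ "a # as"]) auto
  qed
qed simp

lemma maxchain_list_iff_saturated:
  assumes "x \<le> y"
  shows "maxchain_list x y xs \<longleftrightarrow> saturated x y xs"
proof
  assume "maxchain_list x y xs"
  then have s: "sorted_wrt (<) xs" and C: "set xs \<subseteq> {x..y}"
    and max: "\<And>z. z \<in> {x..y} \<Longrightarrow> \<forall>c\<in>set xs. c \<le> z \<or> z \<le> c \<Longrightarrow> z \<in> set xs"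
    unfolding maxchain_list_def maxchain_of_iff chain_of_iff by auto
  have "x \<in> set xs"
    using C assms by (intro max) (auto simp: subset_iff)
  moreover have "y \<in> set xs"
    using C assms by (intro max) (auto simp: subset_iff)
  ultimately have xy: "x \<in> set xs" "y \<in> set xs" by simp_all
  have "hd xs = x"
    using xy s C by (cases xs) (auto simp: subset_iff dest: leD)
  moreover have "last xs = y"
    using xy s C by (cases xs rule: rev_cases) (auto simp: sorted_wrt_append subset_iff dest: leD)
  moreover have "successively covered_by xs"
  proof (rule ccontr)
    assume "\<not> successively covered_by xs"
    then obtain as p q bs where xs: "xs = as @ p # q # bs" and n: "\<not> covered_by p q"
      using not_successively_split by blast
    have "p < q" using s by (auto simp: xs sorted_wrt_append)
    then obtain z where z: "p < z" "z < q" using n by (auto simp: covered_by_def)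
    have as: "\<forall>c\<in>set as. c < p" and bs: "\<forall>c\<in>set bs. q < c"
      using s by (auto simp: xs sorted_wrt_append)
    \<comment> \<open>An element strictly between the neighbours \<open>p\<close> and
      \<open>q\<close> is comparable with the whole list, so maximality puts it into the list, where
      there is no place for it.\<close>
    have "z \<in> set xs"
    proof (rule max)
      show "z \<in> {x..y}" using z C by (auto simp: xs)
      show "\<forall>c\<in>set xs. c \<le> z \<or> z \<le> c"
      proof
        fix c assume "c \<in> set xs"
        then consider "c < p" | "c = p" | "c = q" | "q < c" using as bs by (auto simp: xs)
        then show "c \<le> z \<or> z \<le> c" using z by cases auto
      qed
    qed
    then consider "z < p" | "z = p" | "z = q" | "q < z" using as bs by (auto simp: xs)
    then show False using z by cases auto
  qed
  ultimately show "saturated x y xs" using xy by (auto simp: saturated_def)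
next
  assume s: "saturated x y xs"
  have "\<forall>a\<in>set xs. \<forall>b\<in>set xs. a \<le> b \<or> b \<le> a"
    using saturated_sorted[OF s] by (induction xs) (auto simp: less_imp_le)
  moreover have "set xs \<subseteq> {x..y}" using saturated_bounds[OF s] by auto
  moreover have "\<forall>z\<in>{x..y}. (\<forall>c\<in>set xs. c \<le> z \<or> z \<le> c) \<longrightarrow> z \<in> set xs"
    using saturated_maximal[OF s] by auto
  ultimately show "maxchain_list x y xs"
    unfolding maxchain_list_def maxchain_of_iff chain_of_iff
    using saturated_sorted[OF s] by blast
qed

section \<open>Label sequences of saturated lists\<close>

lemma labels_simps [simp]:
  "labels lab [] = []" "labels lab [x] = []"
  "labels lab (x # y # xs) = lab x y # labels lab (y # xs)"
  by (simp_all add: labels_def)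

lemma labels_Cons: "xs \<noteq> [] \<Longrightarrow> labels lab (x # xs) = lab x (hd xs) # labels lab xs"
  by (cases xs) auto

lemma labels_append: "labels lab (as @ p # bs) = labels lab (as @ [p]) @ labels lab (p # bs)"
proof (induction as)
  case (Cons a as)
  then show ?case by (cases as) auto
qed simp

lemma labels_memE:
  assumes "saturated x y xs" "l \<in> set (labels lab xs)"
  obtains u v where "l = lab u v" "covered_by u v" "x \<le> u" "v \<le> y"
proof -
  have "\<exists>u v. l = lab u v \<and> covered_by u v \<and> u \<in> set xs \<and> v \<in> set xs"
    using assms
  proof (induction xs arbitrary: x)
    case (Cons a xs)
    show ?case
    proof (cases "xs = [] \<or> l \<in> set (labels lab xs)")
      case True
      then have "xs \<noteq> []" "l \<in> set (labels lab xs)"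
        using Cons.prems by auto
      then have "\<exists>u v. l = lab u v \<and> covered_by u v \<and> u \<in> set xs \<and> v \<in> set xs"
        using Cons by (auto simp: saturated_Cons)
      then show ?thesis by auto
    next
      case False
      then have "xs \<noteq> []" "l = lab x (hd xs)" "covered_by x (hd xs)" "a = x"
        using Cons.prems by (auto simp: saturated_Cons labels_Cons)
      then show ?thesis
        by (intro exI[of _ x] exI[of _ "hd xs"]) auto
    qed
  qed simp
  then show thesis using that saturated_bounds[OF assms(1)] by blast
qed

text \<open>The list counterpart of \<open>maxchain_of_cross\<close>; it also records that the label
  of the crossing step occurs in the label sequence.\<close>

lemma saturated_cross:
  assumes "saturated x y xs" "\<not> P x" "P y"
  shows "\<exists>u v. covered_by u v \<and> \<not> P u \<and> P v \<and> lab u v \<in> set (labels lab xs)"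
  using assms
proof (induction xs arbitrary: x)
  case (Cons a xs)
  then have xs: "xs \<noteq> []" "a = x" and c: "covered_by x (hd xs)" "saturated (hd xs) y xs"
    by (auto simp: saturated_Cons split: if_splits)
  show ?case
  proof (cases "P (hd xs)")
    case True
    then show ?thesis using xs c Cons.prems
      by (intro exI[of _ x] exI[of _ "hd xs"]) (simp add: labels_Cons)
  next
    case False
    then obtain u v where "covered_by u v" "\<not> P u" "P v" "lab u v \<in> set (labels lab xs)"
      using Cons.IH[OF c(2)] Cons.prems by blast
    then show ?thesis using xs by (intro exI[of _ u] exI[of _ v]) (simp add: labels_Cons)
  qed
qed (simp add: saturated_def)

section \<open>Join-irreducible labels of covers\<close>

lemma inf_less_iff: "inf x y < x \<longleftrightarrow> \<not> x \<le> y" for x y :: "'a::lattice"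
  by (simp add: less_le_not_le)

lemma less_sup_iff: "x < sup x y \<longleftrightarrow> \<not> y \<le> x" for x y :: "'a::lattice"
  by (simp add: less_le_not_le)

text \<open>The pair \<open>x\<close>, \<open>y\<close> may be any with \<open>y\<close> not below
  \<open>x\<close>, not only a cover. This allows labels for the gaps of a non-maximal chain, and
  for pairs such as \<open>p\<close>, \<open>j\<close> where \<open>j\<close> itself is the upper
  element.\<close>

definition join_label :: "'a::order \<Rightarrow> 'a \<Rightarrow> 'a \<Rightarrow> bool" where
  "join_label x y j \<longleftrightarrow> j \<le> y \<and> \<not> j \<le> x \<and> (\<forall>z<j. z \<le> x)"

lemma join_labelD:
  assumes "join_label x y j"
  shows "j \<le> y" "\<not> j \<le> x" "z < j \<Longrightarrow> z \<le> x"
  using assms by (auto simp: join_label_def)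

lemma join_label_exists:
  fixes x y :: "'a::{finite,order}"
  assumes "\<not> y \<le> x"
  obtains j where "join_label x y j"
proof -
  obtain j where j: "j \<le> y" "\<not> j \<le> x" and min: "\<forall>b\<in>{z. z \<le> y \<and> \<not> z \<le> x}. b \<le> j \<longrightarrow> j = b"
    using finite_has_minimal2[of "{z. z \<le> y \<and> \<not> z \<le> x}" y] assms by auto
  have "z \<le> x" if z: "z < j" for z
  proof (rule ccontr)
    assume "\<not> z \<le> x"
    moreover have "z \<le> j" "z \<le> y" using z j(1) by (simp_all add: order.strict_implies_order order.trans[of z j])
    ultimately have "j = z" using min by blast
    then show False using z by simp
  qed
  then show thesis using that j unfolding join_label_def by blast
qed

text \<open>Everything strictly below \<open>j\<close> is below \<open>x\<close>, so
  \<open>inf j x\<close> is the greatest element strictly below \<open>j\<close> and therefore its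
  only lower cover.\<close>

lemma join_label_JIrr:
  fixes x y j :: "'a::lattice"
  assumes "join_label x y j"
  shows "j \<in> JIrr"
proof -
  have lt: "inf j x < j" using join_labelD(2)[OF assms] by (simp add: inf_less_iff)
  have max: "z \<le> inf j x" if "z < j" for z
    using join_labelD(3)[OF assms that] that by simp
  have "False" if "inf j x < z" "z < j" for z
    using leD[OF max[OF that(2)]] that(1) by blast
  then have "covered_by (inf j x) j"
    using lt unfolding covered_by_def by blast
  moreover have "y = inf j x" if "covered_by y j" for y
    using covered_by_between[OF that, of "inf j x"] covered_byD[OF that] lt max by auto
  ultimately show ?thesis unfolding JIrr_def by blast
qed

text \<open>A join-irreducible labels the cover below itself; hence every join-irreducible occurs as
  a label somewhere.\<close>

lemma JIrr_lower_cover: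
  fixes j :: "'a::{finite,order}"
  assumes "j \<in> JIrr"
  obtains p where "covered_by p j" "join_label p j j"
proof -
  obtain p where p: "covered_by p j" and unique: "\<And>q. covered_by q j \<Longrightarrow> q = p"
    using assms unfolding JIrr_def by blast
  have "z \<le> p" if z: "z < j" for z
    using lower_cover_above[OF z] unique by metis
  then show thesis
    using that[OF p] p unfolding join_label_def by (auto simp: covered_by_def)
qed

lemma join_label_sup:
  fixes x y j :: "'a::lattice"
  assumes "covered_by x y" "join_label x y j"
  shows "sup x j = y"
  using covered_by_between[OF assms(1), of "sup x j"] covered_byD[OF assms(1)] join_labelD[OF assms(2)]
  by (metis le_sup_iff less_imp_le sup_ge1 sup_ge2)

text \<open>Both labels join with \<open>x\<close> to \<open>y\<close>, so by
  join-semidistributivity \<open>inf j k\<close> does too. If this meet were strictly below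
  \<open>j\<close> or \<open>k\<close>, minimality would place it below \<open>x\<close>.\<close>

lemma join_label_unique:
  fixes x y :: "'a::lattice"
  assumes J: "join_semidistributive TYPE('a)" and c: "covered_by x y"
    and j: "join_label x y j" and k: "join_label x y k"
  shows "j = k"
proof -
  have "sup x j = sup x k" "sup x j = y"
    using join_label_sup[OF c j] join_label_sup[OF c k] by simp_all
  then have "sup x (inf j k) = y"
    using J unfolding join_semidistributive_def by blast
  then have "\<not> inf j k \<le> x"
    using covered_byD[OF c] by (auto simp: sup.absorb1)
  then have "\<not> inf j k < j" "\<not> inf j k < k"
    using join_labelD(3)[OF j] join_labelD(3)[OF k] by blast+
  then show ?thesis by (metis inf_le1 inf_le2 order_le_less)
qed

text \<open>
  If \<open>j\<close> is join-irreducible, covers \<open>p\<close>, and \<open>\<kappa> j\<close> is the largest \<open>z\<close> with \<open>inf j z = p\<close>, then the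
  hypotheses on \<open>x\<close> say that \<open>p \<le> x \<le> \<kappa> j\<close>.
\<close>

lemma not_le_sup:
  fixes x y j :: "'a::lattice"
  assumes M: "meet_semidistributive TYPE('a)"
    and x: "\<not> j \<le> x" "\<forall>z<j. z \<le> x" and y: "\<not> j \<le> y" "\<forall>z<j. z \<le> y"
  shows "\<not> j \<le> sup x y"
proof
  assume "j \<le> sup x y"
  have "inf j x < j" "inf j y < j" using x y by (simp_all add: inf_less_iff)
  \<comment> \<open>Each meet is strictly below \<open>j\<close>, hence below the other element as
    well; both are the lower cover of \<open>j\<close>.\<close>
  then have "inf j x = inf j y" using x y by (simp add: order.antisym)
  then have "inf j (sup x y) = inf j x" using M unfolding meet_semidistributive_def by blast
  then show False using \<open>j \<le> sup x y\<close> x by (metis inf.absorb1 inf.cobounded2)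
qed

text \<open>The order dual of \<open>not_le_sup\<close>, needed to recover \<open>j\<close> from its
  kappa.\<close>

lemma not_ge_inf:
  fixes x y m :: "'a::lattice"
  assumes J: "join_semidistributive TYPE('a)"
    and x: "\<not> x \<le> m" "\<forall>z>m. x \<le> z" and y: "\<not> y \<le> m" "\<forall>z>m. y \<le> z"
  shows "\<not> inf x y \<le> m"
proof
  assume "inf x y \<le> m"
  have "m < sup m x" "m < sup m y" using x y by (simp_all add: less_sup_iff)
  then have "sup m x = sup m y" using x y by (simp add: order.antisym)
  then have "sup m (inf x y) = sup m x" using J unfolding join_semidistributive_def by blast
  then show False using \<open>inf x y \<le> m\<close> x by (metis sup.absorb1 sup_ge2)
qed

text \<open>This is the graph of \<open>\<kappa>\<close>, stated without the covers of \<open>j\<close> and \<open>m\<close>.\<close>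

definition kappa_related :: "'a::order \<Rightarrow> 'a \<Rightarrow> bool" where
  "kappa_related j m \<longleftrightarrow> \<not> j \<le> m \<and> (\<forall>z<j. z \<le> m) \<and> (\<forall>z>m. j \<le> z)"

lemma kappa_related_MIrr:
  fixes j m :: "'a::lattice"
  assumes "kappa_related j m"
  shows "m \<in> MIrr"
proof -
  have lt: "m < sup m j" using assms by (simp add: kappa_related_def less_sup_iff)
  have min: "sup m j \<le> z" if "m < z" for z
    using assms that by (simp add: kappa_related_def)
  have "False" if "m < z" "z < sup m j" for z
    using leD[OF min[OF that(1)]] that(2) by blast
  then have "covered_by m (sup m j)"
    using lt unfolding covered_by_def by blast
  moreover have "y = sup m j" if "covered_by m y" for y
    using covered_by_between[OF that, of "sup m j"] covered_byD[OF that] lt min by auto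
  ultimately show ?thesis unfolding MIrr_def by blast
qed

lemma kappa_related_JIrr:
  fixes j m :: "'a::lattice"
  shows "kappa_related j m \<Longrightarrow> j \<in> JIrr"
  by (rule join_label_JIrr[of m j]) (auto simp: kappa_related_def join_label_def)

text \<open>Choose \<open>m\<close> maximal among the elements that are above everything strictly
  below \<open>j\<close> but not above \<open>j\<close>. The lower cover \<open>p\<close> shows that
  there are some, and anything larger than \<open>m\<close> can only fail by being above
  \<open>j\<close>.\<close>

lemma kappa_related_exists_right:
  fixes j :: "'a::{finite,lattice}"
  assumes "j \<in> JIrr"
  obtains m where "kappa_related j m"
proof -
  obtain p where "join_label p j j" using JIrr_lower_cover[OF assms] .
  let ?S = "{m. \<not> j \<le> m \<and> (\<forall>z<j. z \<le> m)}"
  obtain m where m: "m \<in> ?S" and max: "\<forall>b\<in>?S. m \<le> b \<longrightarrow> m = b"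
    using finite_has_maximal2[of ?S p] \<open>join_label p j j\<close> unfolding join_label_def by auto
  have "j \<le> z" if "m < z" for z
  proof (rule ccontr)
    assume "\<not> j \<le> z"
    then have "z \<in> ?S" using m that by (auto intro: order.trans less_imp_le)
    then show False using max that by auto
  qed
  then show thesis using that m unfolding kappa_related_def by blast
qed

text \<open>The label of the unique cover \<open>c\<close> of \<open>m\<close> serves: whatever is
  strictly above \<open>m\<close> is above \<open>c\<close>, hence above the label.\<close>

lemma kappa_related_exists_left:
  fixes m :: "'a::{finite,lattice}"
  assumes "m \<in> MIrr"
  obtains j where "kappa_related j m"
proof -
  obtain c where c: "covered_by m c" and unique: "\<And>y. covered_by m y \<Longrightarrow> y = c"
    using assms unfolding MIrr_def by blast
  have above: "c \<le> z" if z: "m < z" for z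
    using upper_cover_below[OF z] unique by metis
  have "\<not> c \<le> m" using covered_byD[OF c] by auto
  then obtain j where "join_label m c j" using join_label_exists by blast
  then show thesis
    using that above unfolding kappa_related_def join_label_def by (meson order_trans)
qed

lemma kappa_related_right_unique:
  fixes j :: "'a::lattice"
  assumes M: "meet_semidistributive TYPE('a)" and "kappa_related j m" "kappa_related j n"
  shows "m = n"
proof -
  have "\<not> j \<le> sup m n"
    using not_le_sup[OF M] assms unfolding kappa_related_def by blast
  then have "\<not> m < sup m n" "\<not> n < sup m n"
    using assms unfolding kappa_related_def by blast+
  then show ?thesis by (metis sup_ge1 sup_ge2 order_le_less)
qed

lemma kappa_related_left_unique:
  fixes m :: "'a::lattice"
  assumes J: "join_semidistributive TYPE('a)" and "kappa_related j m" "kappa_related k m"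
  shows "j = k"
proof -
  have "\<not> inf j k \<le> m"
    using not_ge_inf[OF J] assms unfolding kappa_related_def by blast
  then have "\<not> inf j k < j" "\<not> inf j k < k"
    using assms unfolding kappa_related_def by blast+
  then show ?thesis by (metis inf_le1 inf_le2 order_le_less)
qed

text \<open>Kappa is a bijection from \<open>JIrr\<close> to \<open>MIrr\<close>, so the two
  equations in \<open>extremal\<close> amount to one.\<close>

lemma card_JIrr_eq_card_MIrr:
  assumes "semidistributive TYPE('a::{finite,lattice})"
  shows "card (JIrr :: 'a set) = card (MIrr :: 'a set)"
proof -
  define f where "f = (\<lambda>j :: 'a. SOME m. kappa_related j m)"
  have f: "kappa_related j (f j)" if "j \<in> JIrr" for j
    unfolding f_def using kappa_related_exists_right[OF that] by (metis someI)
  have "bij_betw f JIrr MIrr"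
  proof (rule bij_betwI')
    fix j k :: 'a assume "j \<in> JIrr" "k \<in> JIrr"
    then show "f j = f k \<longleftrightarrow> j = k"
      using f kappa_related_left_unique assms unfolding semidistributive_def by metis
  next
    fix j :: 'a assume "j \<in> JIrr"
    then show "f j \<in> MIrr" using f kappa_related_MIrr by blast
  next
    fix m :: 'a assume "m \<in> MIrr"
    then obtain j where j: "kappa_related j m" by (rule kappa_related_exists_left)
    then have "j \<in> JIrr" by (rule kappa_related_JIrr)
    then show "\<exists>j\<in>JIrr. m = f j"
      using f j kappa_related_right_unique assms unfolding semidistributive_def by metis
  qed
  then show ?thesis by (rule bij_betw_same_card)
qed

section \<open>Chains that carry every label\<close>

definition chain_labels :: "'a::order set \<Rightarrow> 'a set" where
  "chain_labels C = {j. \<exists>a\<in>C. \<exists>b\<in>C. covered_by a b \<and> join_label a b j}"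

definition full_chain :: "'a::order set \<Rightarrow> bool" where
  "full_chain C \<longleftrightarrow> maxchain_of UNIV C \<and> JIrr \<subseteq> chain_labels C"

lemma full_chainE:
  assumes "full_chain C" "j \<in> JIrr"
  obtains a b where "a \<in> C" "b \<in> C" "covered_by a b" "join_label a b j"
    "\<And>c. c \<in> C \<Longrightarrow> c \<le> a \<or> b \<le> c"
proof -
  obtain a b where ab: "a \<in> C" "b \<in> C" "covered_by a b" "join_label a b j"
    using assms unfolding full_chain_def chain_labels_def by blast
  have "c \<le> a \<or> b \<le> c" if "c \<in> C" for c
    using assms(1) ab that covered_by_between[OF ab(3), of c]
    unfolding full_chain_def maxchain_of_iff chain_of_iff by blast
  then show thesis using that ab by blast
qed

text \<open>Each element \<open>c\<close> of the chain except the least \<open>m\<close> gets a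
  label of the gap between its predecessor \<open>x\<close> in \<open>C\<close> and itself; the gap
  need not be a cover. Labels of different gaps differ: a label of the lower gap is below the lower
  end of the higher gap, which no label of the higher gap is.\<close>

lemma chain_step_labels:
  fixes C :: "'a::{finite,lattice} set"
  assumes C: "chain_of UNIV C" "C \<noteq> {}"
  obtains m f where "m \<in> C" "\<And>c. c \<in> C \<Longrightarrow> m \<le> c" "inj_on f (C - {m})"
    "\<And>c. c \<in> C - {m} \<Longrightarrow>
       f c \<in> JIrr \<and> (\<exists>x\<in>C. x < c \<and> (\<forall>d\<in>C. d \<le> x \<or> c \<le> d) \<and> join_label x c (f c))"
proof -
  have chain: "\<And>x y. x \<in> C \<Longrightarrow> y \<in> C \<Longrightarrow> x \<le> y \<or> y \<le> x" using C unfolding chain_of_iff by blast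
  obtain m where m: "m \<in> C" "\<forall>c\<in>C. c \<le> m \<longrightarrow> m = c"
    using finite_has_minimal[of C] C by auto
  have m_le: "m \<le> c" if "c \<in> C" for c using m chain that by blast
  let ?P = "\<lambda>c x. x \<in> C \<and> x < c \<and> (\<forall>d\<in>C. d \<le> x \<or> c \<le> d)"
  have "\<exists>j. \<exists>x. ?P c x \<and> join_label x c j" if "c \<in> C - {m}" for c
  proof -
    have "m \<in> {x \<in> C. x < c}" using m that m_le by force
    then obtain x where x: "x \<in> C" "x < c" and max: "\<forall>b\<in>{x \<in> C. x < c}. x \<le> b \<longrightarrow> x = b"
      using finite_has_maximal2[of "{x \<in> C. x < c}" m] by auto
    have "d \<le> x \<or> c \<le> d" if "d \<in> C" for d
    proof (cases "c \<le> d")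
      case False
      then have "d < c" using chain[of c d] \<open>c \<in> C - {m}\<close> that by auto
      then show ?thesis using x(1) max that chain[of x d] by auto
    qed simp
    then have "?P c x" using x by blast
    moreover obtain j where "join_label x c j"
      using join_label_exists[of c x] x(2) by (meson leD)
    ultimately show ?thesis by blast
  qed
  then obtain f where f: "\<And>c. c \<in> C - {m} \<Longrightarrow> \<exists>x. ?P c x \<and> join_label x c (f c)" by metis
  have "inj_on f (C - {m})"
  proof (rule inj_onI)
    fix c d assume cd: "c \<in> C - {m}" "d \<in> C - {m}" "f c = f d"
    obtain x y where x: "?P c x" "join_label x c (f c)" and y: "?P d y" "join_label y d (f c)"
      using f[OF cd(1)] f[OF cd(2)] cd(3) by metis
    have "\<not> c \<le> y" "\<not> d \<le> x" using join_labelD[OF x(2)] join_labelD[OF y(2)] by (meson order_trans)+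
    then show "c = d" using x y cd by (meson DiffD1 order.antisym)
  qed
  moreover have "f c \<in> JIrr" if "c \<in> C - {m}" for c using f[OF that] join_label_JIrr by blast
  ultimately show thesis using that[of m f] m m_le f by blast
qed

lemma chain_card_le:
  fixes C :: "'a::{finite,lattice} set"
  assumes "chain_of UNIV C" "C \<noteq> {}"
  shows "card C - 1 \<le> card (JIrr :: 'a set)"
proof -
  obtain m f where "m \<in> C" "inj_on f (C - {m})" "f ` (C - {m}) \<subseteq> (JIrr :: 'a set)"
    using chain_step_labels[OF assms] by (metis image_subsetI)
  then show ?thesis using card_inj_on_le[of f "C - {m}" JIrr] by simp
qed

text \<open>A chain that attains the bound of \<open>chain_card_le\<close> has no proper extension,
  and its injective assignment of labels is onto \<open>JIrr\<close>. By maximality its gaps are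
  covers.\<close>

lemma full_chain_if_card:
  fixes C :: "'a::{finite,lattice} set"
  assumes C: "chain_of UNIV C" "C \<noteq> {}" and card: "card C - 1 = card (JIrr :: 'a set)"
  shows "full_chain C"
proof -
  have "S = C" if "chain_of UNIV S" "C \<subseteq> S" for S
  proof (rule ccontr)
    assume "S \<noteq> C"
    then have "card C < card S" using that by (intro psubset_card_mono) auto
    moreover have "card C \<noteq> 0" using C by simp
    ultimately show False using chain_card_le[OF that(1)] card C that by fastforce
  qed
  then have max: "maxchain_of UNIV C"
    using C unfolding pred_on.maxchain_def by blast
  obtain m f where m: "m \<in> C" and f: "inj_on f (C - {m})"
    "\<And>c. c \<in> C - {m} \<Longrightarrow> f c \<in> JIrr \<and>
      (\<exists>x\<in>C. x < c \<and> (\<forall>d\<in>C. d \<le> x \<or> c \<le> d) \<and> join_label x c (f c))"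
    using chain_step_labels[OF C] by metis
  have "f ` (C - {m}) = JIrr"
    using f card m by (intro card_subset_eq) (auto simp: card_image)
  moreover have "f c \<in> chain_labels C" if c: "c \<in> C - {m}" for c
  proof -
    obtain x where x: "x \<in> C" "x < c" "\<forall>d\<in>C. d \<le> x \<or> c \<le> d" "join_label x c (f c)"
      using f(2)[OF c] by blast
    have False if "x < z" "z < c" for z
    proof -
      have "z \<in> C"
        using max x that unfolding maxchain_of_iff by (meson UNIV_I less_imp_le order_trans)
      then show False using x that by (meson leD)
    qed
    then show ?thesis using x c unfolding chain_labels_def covered_by_def by blast
  qed
  ultimately have "JIrr \<subseteq> chain_labels C" by (metis image_subsetI)
  then show ?thesis using max by (simp add: full_chain_def)
qed

lemma full_chain_card:
  fixes C :: "'a::{finite,lattice} set"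
  assumes J: "join_semidistributive TYPE('a)" and C: "full_chain C"
  shows "C \<noteq> {}" "card C - 1 = card (JIrr :: 'a set)"
proof -
  have ch: "chain_of UNIV C" using C unfolding full_chain_def maxchain_of_iff by blast
  have "\<exists>z. z \<in> C"
    using C unfolding full_chain_def maxchain_of_iff by (metis UNIV_I)
  then show ne: "C \<noteq> {}" by blast
  obtain m f where m: "m \<in> C" and f:
    "\<And>c. c \<in> C - {m} \<Longrightarrow> f c \<in> JIrr \<and>
      (\<exists>x\<in>C. x < c \<and> (\<forall>d\<in>C. d \<le> x \<or> c \<le> d) \<and> join_label x c (f c))"
    and m_le: "\<And>c. c \<in> C \<Longrightarrow> m \<le> c"
    using chain_step_labels[OF ch ne] by metis
  have "j \<in> f ` (C - {m})" if j: "j \<in> JIrr" for j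
  proof -
    obtain a b where ab: "a \<in> C" "b \<in> C" "covered_by a b" "join_label a b j"
      using full_chainE[OF C j] by metis
    then have b: "b \<in> C - {m}" using m_le[of a] covered_byD[OF ab(3)] by auto
    obtain x where x: "x < b" "\<forall>d\<in>C. d \<le> x \<or> b \<le> d" "join_label x b (f b)"
      using f[OF b] by blast
    \<comment> \<open>The gap below \<open>b\<close> chosen by \<open>chain_step_labels\<close> is
      the cover that carries \<open>j\<close>: \<open>a\<close> is in \<open>C\<close> and strictly
      below \<open>b\<close>, so it is at most the predecessor \<open>x\<close>.\<close>
    have "a \<le> x" using x ab covered_byD[OF ab(3)] by (meson leD)
    then have "x = a" using covered_by_between[OF ab(3), of x] x(1) less_imp_le[OF x(1)] by auto
    then have "f b = j" using join_label_unique[OF J ab(3)] x ab by blast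
    then show ?thesis using b by blast
  qed
  then have "card (JIrr :: 'a set) \<le> card (C - {m})"
    by (intro surj_card_le) auto
  then show "card C - 1 = card (JIrr :: 'a set)"
    using chain_card_le[OF ch ne] m by simp
qed

lemma lattice_length_eq_card_JIrr_iff:
  assumes J: "join_semidistributive TYPE('a::{finite,lattice})"
  shows "lattice_length TYPE('a) = card (JIrr :: 'a set) \<longleftrightarrow> (\<exists>C :: 'a set. full_chain C)"
proof -
  let ?L = "{card C - 1 | C :: 'a set. chain_of UNIV C \<and> C \<noteq> {}}"
  have fin: "finite ?L" by simp
  \<comment> \<open>Any one-element chain would do; it ensures that \<open>Max\<close> is taken over
    a nonempty set.\<close>
  have "chain_of UNIV {undefined :: 'a}" by (simp add: chain_of_iff)
  then have ne: "?L \<noteq> {}" by blast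
  have le: "\<forall>n\<in>?L. n \<le> card (JIrr :: 'a set)" using chain_card_le by blast
  have "lattice_length TYPE('a) = card (JIrr :: 'a set) \<longleftrightarrow> card (JIrr :: 'a set) \<in> ?L"
    unfolding lattice_length_def using Max_eq_iff[OF fin ne] le by simp
  also have "\<dots> \<longleftrightarrow> (\<exists>C :: 'a set. full_chain C)"
  proof
    assume "card (JIrr :: 'a set) \<in> ?L"
    then obtain C :: "'a set" where "chain_of UNIV C" "C \<noteq> {}" "card C - 1 = card (JIrr :: 'a set)"
      by force
    then show "\<exists>C :: 'a set. full_chain C" using full_chain_if_card by blast
  next
    assume "\<exists>C :: 'a set. full_chain C"
    then obtain C :: "'a set" where C: "full_chain C" by blast
    then have "chain_of UNIV C" unfolding full_chain_def maxchain_of_iff by blast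
    then show "card (JIrr :: 'a set) \<in> ?L"
      using full_chain_card[OF J C] by (metis (mono_tags, lifting) mem_Collect_eq)
  qed
  finally show ?thesis .
qed

lemma extremal_iff_full_chain:
  assumes "semidistributive TYPE('a::{finite,lattice})"
  shows "extremal TYPE('a) \<longleftrightarrow> (\<exists>C :: 'a set. full_chain C)"
  using assms lattice_length_eq_card_JIrr_iff[where 'a='a] card_JIrr_eq_card_MIrr[OF assms]
  unfolding extremal_def semidistributive_def by auto

section \<open>Left modularity\<close>

text \<open>The two sides of the modular inequality have the same meet with \<open>m\<close> and the
  same join with \<open>m\<close>. If they differ, every cover that starts at the smaller side and
  stays below the larger one has this property too.\<close>

lemma left_modular_element_if_covers:
  fixes m :: "'a::{finite,lattice}"
  assumes "\<And>u v. covered_by u v \<Longrightarrow> inf m u = inf m v \<Longrightarrow> sup m u \<noteq> sup m v"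
  shows "left_modular_element m"
  unfolding left_modular_element_def
proof (intro allI impI, rule ccontr)
  fix x y :: 'a assume "x \<le> y" and ne: "sup x (inf m y) \<noteq> inf (sup x m) y"
  have "sup x (inf m y) \<le> inf (sup x m) y"
    using \<open>x \<le> y\<close> by (auto intro: le_infI1 le_infI2)
  then have "sup x (inf m y) < inf (sup x m) y" using ne by (rule order.not_eq_order_implies_strict[rotated])
  then obtain v where c: "covered_by (sup x (inf m y)) v" and v: "v \<le> inf (sup x m) y"
    by (rule upper_cover_below)
  let ?u = "sup x (inf m y)"
  have "?u \<le> v" using covered_byD[OF c] by (rule less_imp_le)
  have "inf m v \<le> inf m y" using v by (simp add: le_infI2)
  then have "inf m v \<le> inf m ?u" by (simp add: le_supI2)
  then have "inf m ?u = inf m v"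
    by (rule order.antisym[OF inf_mono[OF order_refl \<open>?u \<le> v\<close>]])
  moreover have "sup m x \<le> sup m ?u" by (rule sup_mono) auto
  then have "v \<le> sup m ?u" using v by (metis le_infE order_trans sup_commute)
  then have "sup m v \<le> sup m ?u" by (simp add: le_supI1)
  then have "sup m ?u = sup m v"
    by (rule order.antisym[OF sup_mono[OF order_refl \<open>?u \<le> v\<close>]])
  ultimately show False using assms[OF c] by blast
qed

lemma left_modular_iff_full_chain:
  assumes S: "semidistributive TYPE('a::{finite,lattice})"
  shows "left_modular TYPE('a) \<longleftrightarrow> (\<exists>C :: 'a set. full_chain C)"
proof
  assume "\<exists>C :: 'a set. full_chain C"
  then obtain C :: "'a set" where C: "full_chain C" by blast
  have "left_modular_element c" if c: "c \<in> C" for c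
  proof (rule left_modular_element_if_covers, rule notI)
    fix u v assume uv: "covered_by u v" and eq: "inf c u = inf c v" "sup c u = sup c v"
    have "\<not> v \<le> u" using covered_byD[OF uv] by (simp add: less_le_not_le)
    then obtain j where j: "join_label u v j" by (rule join_label_exists)
    obtain a b where ab: "join_label a b j" "c \<le> a \<or> b \<le> c"
      using full_chainE[OF C join_label_JIrr[OF j]] c by metis
    have "\<not> b \<le> c"
    proof
      assume "b \<le> c"
      then have "j \<le> inf c v" using join_labelD[OF j] join_labelD[OF ab(1)] by auto
      then show False using eq(1) join_labelD[OF j] by (metis le_infE)
    qed
    then have "c \<le> a" using ab by blast
    \<comment> \<open>Both \<open>a\<close> and \<open>u\<close> are below the kappa of
      \<open>j\<close>, hence so is their join. But \<open>j \<le> v\<close>, and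
      \<open>sup c v = sup c u\<close> is below \<open>sup a u\<close>.\<close>
    have "\<not> j \<le> sup a u"
      using not_le_sup S j ab(1) unfolding semidistributive_def join_label_def by blast
    moreover have "j \<le> sup c v" using join_labelD(1)[OF j] by (simp add: le_supI2)
    ultimately show False using \<open>c \<le> a\<close> eq(2) by (metis order_trans sup_mono order_refl)
  qed
  then show "left_modular TYPE('a)" using C unfolding left_modular_def full_chain_def by blast
next
  assume "left_modular TYPE('a)"
  then obtain C :: "'a set" where C: "maxchain_of UNIV C" and lm: "\<And>m. m \<in> C \<Longrightarrow> left_modular_element m"
    unfolding left_modular_def by blast
  obtain l u :: 'a where lu: "\<And>x. l \<le> x" "\<And>x. x \<le> u" using bounded_finite_lattice by blast
  have C_lu: "l \<in> C" "u \<in> C" using C lu unfolding maxchain_of_iff by blast+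
  have "j \<in> chain_labels C" if j: "j \<in> JIrr" for j
  proof -
    obtain p where p: "covered_by p j" "join_label p j j" using JIrr_lower_cover[OF j] .
    have "\<not> j \<le> l" using lu(1) covered_byD[OF p(1)] by (meson leD order_trans)
    then obtain a b where ab: "a \<in> C" "b \<in> C" "covered_by a b" "\<not> j \<le> a" "j \<le> b"
      using maxchain_of_cross[OF C, of "\<lambda>c. j \<le> c" l u] C_lu lu by (metis order_trans)
    have "inf a j \<le> p"
      using join_labelD(3)[OF p(2), of "inf j a"] ab(4) by (simp add: inf_commute[of a] inf_less_iff)
    \<comment> \<open>Left modularity of \<open>a\<close> for the pair \<open>p \<le> j\<close>:
      joining \<open>p\<close> to \<open>a\<close> does not reach \<open>j\<close>. As
      \<open>sup p a\<close> is below the cover \<open>b\<close> of \<open>a\<close>, it must be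
      \<open>a\<close>, so \<open>a\<close> contains everything strictly below
      \<open>j\<close>.\<close>
    then have "inf (sup p a) j = p"
      using lm[OF ab(1)] less_imp_le[OF covered_byD[OF p(1)]]
      unfolding left_modular_element_def by (metis sup.absorb1)
    then have "\<not> j \<le> sup p a" using covered_byD[OF p(1)] by (metis inf.absorb2 less_irrefl)
    moreover have "sup p a \<le> b" using ab covered_byD[OF ab(3)] covered_byD[OF p(1)] by auto
    ultimately have "sup p a = a" using covered_by_between[OF ab(3), of "sup p a"] ab by auto
    then have "\<forall>z<j. z \<le> a" using join_labelD(3)[OF p(2)] by (metis le_sup_iff order_refl order_trans)
    then show ?thesis using ab unfolding chain_labels_def join_label_def by blast
  qed
  then show "\<exists>C :: 'a set. full_chain C" using C unfolding full_chain_def by blast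
qed

section \<open>The edge labeling of a full chain\<close>

text \<open>The increasing chain is built greedily from the bottom. That later labels exceed
  \<open>lab x w\<close> keeps it increasing; that \<open>w\<close> alone has the least label among
  the covers of \<open>x\<close> makes it lexicographically least; and a chain that starts elsewhere
  starts with a larger label but must contain one that is at most \<open>lab x w\<close>, so it
  cannot increase.\<close>

lemma EL_labelingI_first_step:
  fixes lab :: "'a::{finite,order} \<Rightarrow> 'a \<Rightarrow> 'b::linorder"
  assumes step: "\<And>x y. x < y \<Longrightarrow> \<exists>w. covered_by x w \<and> w \<le> y \<and>
      (\<forall>u v. covered_by u v \<longrightarrow> w \<le> u \<longrightarrow> v \<le> y \<longrightarrow> lab x w < lab u v) \<and>
      (\<forall>v. covered_by x v \<longrightarrow> v \<le> y \<longrightarrow> lab x w < lab x v \<or> v = w) \<and>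
      (\<forall>xs. saturated x y xs \<longrightarrow> (\<exists>l\<in>set (labels lab xs). l \<le> lab x w))"
  shows "EL_labeling lab"
proof -
  have main: "\<exists>xs. saturated x y xs \<and> sorted_wrt (<) (labels lab xs) \<and>
      (\<forall>ys. saturated x y ys \<longrightarrow> ord_class.lexordp_eq (labels lab xs) (labels lab ys) \<and>
         (sorted_wrt (<) (labels lab ys) \<longrightarrow> ys = xs))" if "x \<le> y" for x y :: 'a
    using that
  proof (induction x rule: measure_induct_rule[of "\<lambda>x. card {x..y}"])
    case (less x)
    show ?case
    proof (cases "x = y")
      case True
      then show ?thesis by (auto simp: saturated_self)
    next
      case False
      then have "x < y" using less.prems by simp
      then obtain w where w: "covered_by x w" "w \<le> y"
        and above: "\<And>u v. covered_by u v \<Longrightarrow> w \<le> u \<Longrightarrow> v \<le> y \<Longrightarrow> lab x w < lab u v"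
        and first: "\<And>v. covered_by x v \<Longrightarrow> v \<le> y \<Longrightarrow> lab x w < lab x v \<or> v = w"
        and small: "\<And>xs. saturated x y xs \<Longrightarrow> \<exists>l\<in>set (labels lab xs). l \<le> lab x w"
        using step by metis
      have "x < w" using w(1) by (rule covered_byD)
      then have "{w..y} \<subseteq> {x..y}" "x \<in> {x..y} - {w..y}" using \<open>x < y\<close> by (auto simp: less_imp_le)
      then have "{w..y} \<subset> {x..y}" by blast
      then have "card {w..y} < card {x..y}" by (intro psubset_card_mono) auto
      then obtain xs where xs: "saturated w y xs" "sorted_wrt (<) (labels lab xs)"
        and lex: "\<And>ys. saturated w y ys \<Longrightarrow> ord_class.lexordp_eq (labels lab xs) (labels lab ys)"
        and unique: "\<And>ys. saturated w y ys \<Longrightarrow> sorted_wrt (<) (labels lab ys) \<Longrightarrow> ys = xs"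
        using less.IH[of w] w(2) by blast
      have hd: "xs \<noteq> []" "hd xs = w" using xs(1) by (auto simp: saturated_def)
      have labs: "labels lab (x # xs) = lab x w # labels lab xs" using hd by (simp add: labels_Cons)
      have "saturated x y (x # xs)" using hd xs(1) w(1) by (simp add: saturated_Cons)
      moreover have "\<forall>l\<in>set (labels lab xs). lab x w < l"
        using above labels_memE[OF xs(1)] by metis
      then have "sorted_wrt (<) (labels lab (x # xs))" using labs xs(2) by simp
      moreover have "ord_class.lexordp_eq (labels lab (x # xs)) (labels lab ys) \<and>
          (sorted_wrt (<) (labels lab ys) \<longrightarrow> ys = x # xs)" if ys: "saturated x y ys" for ys
      proof -
        obtain zs where zs: "ys = x # zs" "zs \<noteq> []" "covered_by x (hd zs)" "saturated (hd zs) y zs"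
          using saturated_ConsE[OF ys \<open>x < y\<close>] .
        have labs': "labels lab ys = lab x (hd zs) # labels lab zs"
          using zs by (simp add: labels_Cons)
        have "hd zs \<le> y" using saturated_le[OF zs(4)] .
        then consider "lab x w < lab x (hd zs)" | "hd zs = w" using first zs(3) by blast
        then show ?thesis
        proof cases
          case 1
          have "\<not> sorted_wrt (<) (labels lab ys)"
          proof
            assume sorted: "sorted_wrt (<) (labels lab ys)"
            obtain l where "l \<in> set (labels lab ys)" "l \<le> lab x w" using small[OF ys] by blast
            then have "lab x (hd zs) \<le> lab x w" using sorted unfolding labs' by auto
            then show False using 1 by simp
          qed
          moreover have "ord_class.lexordp_eq (labels lab (x # xs)) (labels lab ys)"
            using 1 labs labs' by simp
          ultimately show ?thesis by blast
        next
          case 2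
          then show ?thesis using lex[of zs] unique[of zs] zs labs labs' by auto
        qed
      qed
      ultimately show ?thesis by blast
    qed
  qed
  show ?thesis
    unfolding EL_labeling_def
  proof (intro allI impI)
    fix x y :: 'a assume "x \<le> y"
    note iff = maxchain_list_iff_saturated[OF \<open>x \<le> y\<close>]
    obtain xs where xs: "saturated x y xs" "sorted_wrt (<) (labels lab xs)"
      and lex: "\<And>ys. saturated x y ys \<Longrightarrow> ord_class.lexordp_eq (labels lab xs) (labels lab ys)"
      and unique: "\<And>ys. saturated x y ys \<Longrightarrow> sorted_wrt (<) (labels lab ys) \<Longrightarrow> ys = xs"
      using main[OF \<open>x \<le> y\<close>] by blast
    show "(\<exists>!xs. maxchain_list x y xs \<and> sorted_wrt (<) (labels lab xs)) \<and>
        (\<forall>xs ys. maxchain_list x y xs \<longrightarrow> sorted_wrt (<) (labels lab xs) \<longrightarrow>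
           maxchain_list x y ys \<longrightarrow> ord_class.lexordp_eq (labels lab xs) (labels lab ys))"
      unfolding iff
    proof (intro conjI allI impI)
      show "\<exists>!xs. saturated x y xs \<and> sorted_wrt (<) (labels lab xs)"
        using xs unique by blast
      fix zs ys assume "saturated x y zs" "sorted_wrt (<) (labels lab zs)" "saturated x y ys"
      then show "ord_class.lexordp_eq (labels lab zs) (labels lab ys)"
        using unique[of zs] lex[of ys] by simp
    qed
  qed
qed

text \<open>For a join-irreducible \<open>j\<close> and a full chain, this is the position of the
  step labelled \<open>j\<close>, counted from 1. It is defined for every element, which makes it
  monotone and lets it be minimised over all of an interval.\<close>

definition chain_rank :: "'a::order set \<Rightarrow> 'a \<Rightarrow> nat" where
  "chain_rank C j = card {c \<in> C. \<not> j \<le> c}"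

lemma chain_rank_mono:
  fixes C :: "'a::{finite,order} set"
  shows "j \<le> k \<Longrightarrow> chain_rank C j \<le> chain_rank C k"
  unfolding chain_rank_def by (rule card_mono) (auto intro: order_trans)

text \<open>Some chain element is above \<open>j\<close> but not above \<open>k\<close>; it is at
  most the lower end \<open>a\<close> of the step labelled \<open>k\<close>. So \<open>a\<close> is
  above \<open>j\<close> and below the kappa of \<open>k\<close>.\<close>

lemma chain_rank_less_obtain:
  fixes C :: "'a::{finite,lattice} set"
  assumes C: "full_chain C" and k: "k \<in> JIrr" and less: "chain_rank C j < chain_rank C k"
  obtains a where "j \<le> a" "\<not> k \<le> a" "\<forall>z<k. z \<le> a"
proof -
  have "\<not> {c \<in> C. \<not> k \<le> c} \<subseteq> {c \<in> C. \<not> j \<le> c}"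
    using less card_mono[of "{c \<in> C. \<not> j \<le> c}" "{c \<in> C. \<not> k \<le> c}"]
    unfolding chain_rank_def by auto
  then obtain c where c: "c \<in> C" "\<not> k \<le> c" "j \<le> c" by blast
  obtain a b where ab: "join_label a b k" "c \<le> a \<or> b \<le> c"
    using full_chainE[OF C k] c(1) by metis
  then have "c \<le> a" using c(2) join_labelD(1)[OF ab(1)] by (meson order_trans)
  then show thesis using that[of a] c(3) ab(1) unfolding join_label_def by (meson order_trans)
qed

lemma chain_rank_inj_on:
  fixes C :: "'a::{finite,lattice} set"
  assumes J: "join_semidistributive TYPE('a)" and C: "full_chain C"
  shows "inj_on (chain_rank C) JIrr"
proof (rule inj_onI)
  fix j k :: 'a assume j: "j \<in> JIrr" and k: "k \<in> JIrr" and eq: "chain_rank C j = chain_rank C k"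
  \<comment> \<open>If the step labelled \<open>i\<close> ends at or below the start of the step
    labelled \<open>h\<close>, then \<open>a'\<close> itself witnesses the strict inclusion. Equal
    ranks thus leave only one possible step.\<close>
  have *: "chain_rank C i < chain_rank C h"
    if ab: "covered_by a b" and i: "join_label a b i" "\<And>c. c \<in> C \<Longrightarrow> c \<le> a \<or> b \<le> c"
      and h: "join_label a' b' h" "a' \<in> C" and "b \<le> a'" for a b i a' b' h
    unfolding chain_rank_def
  proof (rule psubset_card_mono)
    have "\<not> h \<le> c" if "c \<in> C" "\<not> i \<le> c" for c
    proof -
      have "\<not> b \<le> c" using join_labelD(1)[OF i(1)] that(2) by (meson order_trans)
      then have "c \<le> a'"
        using i(2)[OF that(1)] covered_byD[OF ab] \<open>b \<le> a'\<close> by (meson less_imp_le order_trans)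
      then show ?thesis using join_labelD(2)[OF h(1)] by (meson order_trans)
    qed
    moreover have "i \<le> a'" "\<not> h \<le> a'"
      using join_labelD(1)[OF i(1)] join_labelD(2)[OF h(1)] \<open>b \<le> a'\<close> by (auto intro: order_trans)
    ultimately show "{c \<in> C. \<not> i \<le> c} \<subset> {c \<in> C. \<not> h \<le> c}" using h(2) by blast
  qed simp
  obtain a b where ab: "a \<in> C" "b \<in> C" "covered_by a b" "join_label a b j"
    and split_ab: "\<And>c. c \<in> C \<Longrightarrow> c \<le> a \<or> b \<le> c"
    using full_chainE[OF C j] by blast
  obtain a' b' where ab': "a' \<in> C" "b' \<in> C" "covered_by a' b'" "join_label a' b' k"
    and split_ab': "\<And>c. c \<in> C \<Longrightarrow> c \<le> a' \<or> b' \<le> c"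
    using full_chainE[OF C k] by blast
  have "\<not> b \<le> a'" "\<not> b' \<le> a"
    using *[OF ab(3,4) split_ab ab'(4,1)] *[OF ab'(3,4) split_ab' ab(4,1)] eq by fastforce+
  then have "a = a'" "b \<le> b'" "b' \<le> b"
    using split_ab[OF ab'(1)] split_ab'[OF ab(1)] split_ab[OF ab'(2)] split_ab'[OF ab(2)]
      covered_byD[OF ab(3)] covered_byD[OF ab'(3)] by (auto dest: leD)
  then show "j = k" using join_label_unique[OF J ab(3,4)] ab'(4) by simp
qed

lemma full_chain_imp_EL_labeling:
  fixes C :: "'a::{finite,lattice} set"
  assumes S: "semidistributive TYPE('a)" and C: "full_chain C"
  shows "EL_labeling (\<lambda>x y. chain_rank C (SOME j. join_label x y j))"
proof -
  have J: "join_semidistributive TYPE('a)" and M: "meet_semidistributive TYPE('a)"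
    using S by (auto simp: semidistributive_def)
  define lab where "lab = (\<lambda>x y. chain_rank C (SOME j. join_label x y j))"
  have lab: "lab x y = chain_rank C j" if "covered_by x y" "join_label x y j" for x y j
    unfolding lab_def using join_label_unique[OF J that(1)] that(2) by (metis someI)
  have label: "\<exists>j. join_label x y j" if "covered_by x y" for x y :: 'a
  proof -
    have "\<not> y \<le> x" using covered_byD[OF that] by (simp add: less_le_not_le)
    then show ?thesis using join_label_exists by blast
  qed
  have "EL_labeling lab"
  proof (rule EL_labelingI_first_step)
    fix x y :: 'a assume "x < y"
    then have "y \<in> {j. j \<le> y \<and> \<not> j \<le> x}" by (simp add: less_le_not_le)
    then obtain j0 where j0: "j0 \<le> y" "\<not> j0 \<le> x"
      and min0: "\<And>k. k \<le> y \<Longrightarrow> \<not> k \<le> x \<Longrightarrow> chain_rank C j0 \<le> chain_rank C k"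
      using ex_has_least_nat[of "\<lambda>j. j \<le> y \<and> \<not> j \<le> x" y "chain_rank C"] by auto
    \<comment> \<open>The minimiser \<open>j0\<close> need not be join-irreducible. A label below it
      is, and by monotonicity it has the same least rank.\<close>
    obtain j where j: "join_label x j0 j" using join_label_exists[OF j0(2)] .
    have "chain_rank C j = chain_rank C j0"
      using chain_rank_mono[OF join_labelD(1)[OF j]] min0[of j] join_labelD[OF j] j0
      by (meson order.antisym order_trans)
    then have min: "chain_rank C j \<le> chain_rank C k" if "k \<le> y" "\<not> k \<le> x" for k
      using min0 that by simp
    have j_y: "j \<le> y" using join_labelD(1)[OF j] j0(1) by (rule order_trans)
    have j_x: "\<not> j \<le> x" using join_labelD(2)[OF j] .
    have jJ: "j \<in> JIrr" using join_label_JIrr[OF j] .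
    define w where "w = sup x j"
    have "x < w" using j_x by (simp add: w_def less_sup_iff)
    have "w \<le> y" using \<open>x < y\<close> j_y by (simp add: w_def less_imp_le)
    have lower: "chain_rank C j \<le> lab u v" if uv: "covered_by u v" "x \<le> u" "v \<le> y" for u v
    proof -
      obtain k where k: "join_label u v k" using label[OF uv(1)] by blast
      have "k \<le> y" "\<not> k \<le> x" using join_labelD[OF k] uv by (meson order_trans)+
      then show ?thesis using min lab[OF uv(1) k] by simp
    qed
    \<comment> \<open>Every cover between \<open>x\<close> and \<open>sup x j\<close> carries the
      label \<open>j\<close>. A label of larger rank would contradict closure under joins of the
      elements below its kappa, and a smaller rank is excluded by the choice of
      \<open>j\<close>.\<close>
    have eq: "k = j" if uv: "covered_by u v" "x \<le> u" "v \<le> w" and k: "join_label u v k" for u v k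
    proof -
      have "\<not> chain_rank C j < chain_rank C k"
      proof
        assume "chain_rank C j < chain_rank C k"
        then obtain a where a: "j \<le> a" "\<not> k \<le> a" "\<forall>z<k. z \<le> a"
          using chain_rank_less_obtain[OF C join_label_JIrr[OF k]] by blast
        then have "\<not> k \<le> sup u a"
          using not_le_sup[OF M] k unfolding join_label_def by blast
        moreover have "w \<le> sup u a" unfolding w_def using uv(2) a(1) by (rule sup_mono)
        ultimately show False using join_labelD(1)[OF k] uv(3) by (meson order_trans)
      qed
      moreover have "chain_rank C j \<le> chain_rank C k"
        using lower[OF uv(1,2)] uv(3) \<open>w \<le> y\<close> lab[OF uv(1) k] by (metis order_trans)
      ultimately show ?thesis
        using chain_rank_inj_on[OF J C] jJ join_label_JIrr[OF k] by (auto dest: inj_onD)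
    qed
    obtain w' where w': "covered_by x w'" "w' \<le> w" using upper_cover_below[OF \<open>x < w\<close>] .
    obtain k where "join_label x w' k" using label[OF w'(1)] by blast
    then have lab': "join_label x w' j" using eq[OF w'(1) order_refl w'(2)] by blast
    \<comment> \<open>The first cover above \<open>x\<close> inside \<open>w\<close> already has
      label \<open>j\<close>, so it equals \<open>sup x j\<close>; hence \<open>w\<close> covers
      \<open>x\<close>.\<close>
    then have "w = w'" unfolding w_def using join_label_sup[OF w'(1)] by blast
    then have c: "covered_by x w" "join_label x w j" using w' lab' by auto
    then have lab_w: "lab x w = chain_rank C j" by (rule lab)
    have "lab x w < lab u v" if uv: "covered_by u v" "w \<le> u" "v \<le> y" for u v
    proof -
      obtain k where k: "join_label u v k" using label[OF uv(1)] by blast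
      have "x \<le> u" using \<open>x < w\<close> uv(2) by simp
      moreover have "k \<noteq> j" using join_labelD(2)[OF k] uv(2) unfolding w_def by auto
      then have "chain_rank C j \<noteq> chain_rank C k"
        using chain_rank_inj_on[OF J C] jJ join_label_JIrr[OF k] by (auto dest: inj_onD)
      ultimately show ?thesis
        using lower[OF uv(1) _ uv(3)] lab[OF uv(1) k] lab_w by simp
    qed
    moreover have "lab x w < lab x v \<or> v = w" if v: "covered_by x v" "v \<le> y" for v
    proof -
      obtain k where k: "join_label x v k" using label[OF v(1)] by blast
      have "v = w" if "k = j" using join_label_sup[OF v(1) k] that w_def by simp
      moreover have "k = j" if "chain_rank C j = chain_rank C k"
        using chain_rank_inj_on[OF J C] jJ join_label_JIrr[OF k] that by (auto dest: inj_onD)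
      ultimately show ?thesis
        using lower[OF v(1) order_refl v(2)] lab[OF v(1) k] lab_w by fastforce
    qed
    moreover have "\<exists>l\<in>set (labels lab xs). l \<le> lab x w" if xs: "saturated x y xs" for xs
    proof -
      obtain u v where uv: "covered_by u v" "\<not> j \<le> u" "j \<le> v" "lab u v \<in> set (labels lab xs)"
        using saturated_cross[of x y xs "\<lambda>c. j \<le> c" lab] xs j_x j_y by blast
      \<comment> \<open>The chain must pass from elements not above \<open>j\<close> to elements
        above it. The label of that step can be found below \<open>j\<close>, so its rank is at most
        that of \<open>j\<close>.\<close>
      obtain k where k: "join_label u j k" using join_label_exists[OF uv(2)] .
      then have "join_label u v k" using uv(3) unfolding join_label_def by (meson order_trans)
      then have "lab u v = chain_rank C k" using lab[OF uv(1)] by blast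
      then show ?thesis using uv(4) chain_rank_mono[OF join_labelD(1)[OF k]] lab_w by auto
    qed
    ultimately show "\<exists>w. covered_by x w \<and> w \<le> y \<and>
        (\<forall>u v. covered_by u v \<longrightarrow> w \<le> u \<longrightarrow> v \<le> y \<longrightarrow> lab x w < lab u v) \<and>
        (\<forall>v. covered_by x v \<longrightarrow> v \<le> y \<longrightarrow> lab x w < lab x v \<or> v = w) \<and>
        (\<forall>xs. saturated x y xs \<longrightarrow> (\<exists>l\<in>set (labels lab xs). l \<le> lab x w))"
      using c(1) \<open>w \<le> y\<close> by blast
  qed
  then show ?thesis unfolding lab_def .
qed

section \<open>Lexicographic shelling\<close>

lemma sorted_wrt_less_distinct: "sorted_wrt (<) xs \<Longrightarrow> distinct xs" for xs :: "'a::order list"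
  by (induction xs) auto

lemma sorted_wrt_less_unique:
  fixes xs ys :: "'a::order list"
  assumes "sorted_wrt (<) xs" "sorted_wrt (<) ys" "set xs = set ys"
  shows "xs = ys"
  using assms
proof (induction xs arbitrary: ys)
  case (Cons x xs)
  then obtain y ys' where ys: "ys = y # ys'" by (cases ys) auto
  have "x = y \<or> y < x" "y = x \<or> x < y"
    using Cons.prems ys by (auto simp: set_eq_iff)
  then have "x = y" by auto
  moreover have "x \<notin> set xs" "y \<notin> set ys'" using Cons.prems ys by auto
  then have "set xs = set ys'" using Cons.prems(3) ys \<open>x = y\<close> by auto
  ultimately show ?case using Cons ys by simp
qed simp

section \<open>Descents of label sequences\<close>

lemma not_sorted_labels_split:
  fixes lab :: "'a \<Rightarrow> 'a \<Rightarrow> 'b::linorder"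
  assumes "\<not> sorted_wrt (<) (labels lab xs)"
  shows "\<exists>as p q r bs. xs = as @ p # q # r # bs \<and> \<not> lab p q < lab q r"
proof -
  have "\<not> successively (<) (labels lab xs)"
    using assms by (simp add: successively_conv_sorted_wrt)
  then show ?thesis
  proof (induction xs rule: induct_list012)
    case (3 x y zs)
    then obtain z zs' where zs: "zs = z # zs'" by (cases zs) auto
    show ?case
    proof (cases "lab x y < lab y z")
      case True
      then have "\<not> successively (<) (labels lab (y # zs))" using 3 zs by simp
      then obtain as p q r bs where "y # zs = as @ p # q # r # bs" "\<not> lab p q < lab q r"
        using 3 by blast
      then show ?thesis by (intro exI[of _ "x # as"]) auto
    next
      case False
      then show ?thesis using zs by (intro exI[of _ "[]"]) auto
    qed
  qed simp_all
qed

lemma EL_labelingE: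
  fixes lab :: "'a::{finite,order} \<Rightarrow> 'a \<Rightarrow> 'b::linorder"
  assumes "EL_labeling lab" "x \<le> y"
  obtains xs where "saturated x y xs" "sorted_wrt (<) (labels lab xs)"
    "\<And>ys. saturated x y ys \<Longrightarrow> ord_class.lexordp_eq (labels lab xs) (labels lab ys)"
    "\<And>ys. saturated x y ys \<Longrightarrow> sorted_wrt (<) (labels lab ys) \<Longrightarrow> ys = xs"
proof -
  have "(\<exists>!xs. maxchain_list x y xs \<and> sorted_wrt (<) (labels lab xs)) \<and>
      (\<forall>xs ys. maxchain_list x y xs \<longrightarrow> sorted_wrt (<) (labels lab xs) \<longrightarrow>
         maxchain_list x y ys \<longrightarrow> ord_class.lexordp_eq (labels lab xs) (labels lab ys))"
    using assms unfolding EL_labeling_def by blast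
  then have *: "\<exists>!xs. saturated x y xs \<and> sorted_wrt (<) (labels lab xs)"
    "\<forall>xs ys. saturated x y xs \<longrightarrow> sorted_wrt (<) (labels lab xs) \<longrightarrow>
       saturated x y ys \<longrightarrow> ord_class.lexordp_eq (labels lab xs) (labels lab ys)"
    unfolding maxchain_list_iff_saturated[OF assms(2)] by blast+
  from *(1) obtain xs where "saturated x y xs" "sorted_wrt (<) (labels lab xs)"
    "\<forall>ys. saturated x y ys \<and> sorted_wrt (<) (labels lab ys) \<longrightarrow> ys = xs"
    by (rule ex1E) blast
  then show thesis using *(2) that by blast
qed

text \<open>Lexicographic minimality alone gives a weak inequality. In case of a tie, prefix
  \<open>x\<close> to the increasing chain from \<open>u\<close> to \<open>y\<close>: comparing the
  tails shows that its next label is at least the second label of \<open>x # xs\<close>, so the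
  prefixed chain increases too, against uniqueness.\<close>

lemma EL_first_label_less:
  fixes lab :: "'a::{finite,order} \<Rightarrow> 'a \<Rightarrow> 'b::linorder"
  assumes EL: "EL_labeling lab" and xs: "saturated x y (x # xs)" "xs \<noteq> []"
    and inc: "sorted_wrt (<) (labels lab (x # xs))"
    and u: "covered_by x u" "u \<le> y" "u \<noteq> hd xs"
  shows "lab x (hd xs) < lab x u"
proof (rule ccontr)
  assume contra: "\<not> lab x (hd xs) < lab x u"
  have xs': "covered_by x (hd xs)" "saturated (hd xs) y xs"
    using xs by (auto simp: saturated_Cons)
  have "x \<le> y" using saturated_le[OF xs(1)] .
  have lex: "ord_class.lexordp_eq (labels lab (x # xs)) (labels lab ys)"
    and unique: "sorted_wrt (<) (labels lab ys) \<Longrightarrow> ys = x # xs" if "saturated x y ys" for ys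
  proof -
    obtain zs where zs: "\<And>ys. saturated x y ys \<Longrightarrow> ord_class.lexordp_eq (labels lab zs) (labels lab ys)"
      "\<And>ys. saturated x y ys \<Longrightarrow> sorted_wrt (<) (labels lab ys) \<Longrightarrow> ys = zs"
      by (rule EL_labelingE[OF EL \<open>x \<le> y\<close>]) (rule that)
    have "x # xs = zs" using zs(2) xs(1) inc by blast
    then show "ord_class.lexordp_eq (labels lab (x # xs)) (labels lab ys)"
      "sorted_wrt (<) (labels lab ys) \<Longrightarrow> ys = x # xs"
      using zs that by blast+
  qed
  obtain ms where ms: "saturated u y ms" "sorted_wrt (<) (labels lab ms)"
    by (rule EL_labelingE[OF EL u(2)]) (rule that)
  have hd: "ms \<noteq> []" "hd ms = u" using ms(1) by (auto simp: saturated_def)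
  have xms: "saturated x y (x # ms)" using hd u(1) ms(1) by (simp add: saturated_Cons)
  \<comment> \<open>This guarantees a second label on \<open>x # xs\<close>: if \<open>x\<close>
    were covered by \<open>y\<close>, then \<open>u\<close> could only be
    \<open>y = hd xs\<close>.\<close>
  have "hd xs \<noteq> y"
  proof
    assume "hd xs = y"
    then have "u = x \<or> u = hd xs"
      using covered_by_between[OF xs'(1), of u] u(2) covered_byD[OF u(1)] by (simp add: less_imp_le)
    then show False using u(1,3) covered_byD by blast
  qed
  then have "hd xs < y" using saturated_le[OF xs'(2)] by simp
  then obtain xs2 where xs2: "xs = hd xs # xs2" "xs2 \<noteq> []"
    using saturated_ConsE[OF xs'(2)] by blast
  have "labels lab xs = lab (hd xs) (hd xs2) # labels lab xs2"
    by (subst xs2(1)) (rule labels_Cons[OF xs2(2)])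
  then have labs: "labels lab (x # xs) = lab x (hd xs) # lab (hd xs) (hd xs2) # labels lab xs2"
    using xs(2) by (simp add: labels_Cons)
  have lab_ms: "labels lab (x # ms) = lab x u # labels lab ms" using hd by (simp add: labels_Cons)
  have eq: "lab x u = lab x (hd xs)" and
    tail: "ord_class.lexordp_eq (lab (hd xs) (hd xs2) # labels lab xs2) (labels lab ms)"
    using lex[OF xms] contra unfolding labs lab_ms by auto
  have "sorted_wrt (<) (labels lab (x # ms))"
  proof (cases "labels lab ms")
    case (Cons l ls)
    then have "lab x u < l" using tail inc eq unfolding labs by auto
    then show ?thesis using ms(2) unfolding lab_ms Cons by auto
  qed (simp add: lab_ms)
  then have "ms = xs" using unique[OF xms] by simp
  then show False using hd u(3) by simp
qed

text \<open>
  If \<open>ys\<close> does not precede \<open>xs\<close>, then \<open>ys\<close> has a descent at an element outside \<open>xs\<close>: between the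
  place where \<open>ys\<close> leaves \<open>xs\<close> and the place where it first returns, \<open>ys\<close> cannot be increasing,
  since it would then start with a smaller label than \<open>xs\<close> does.
\<close>

lemma lex_descent:
  fixes lab :: "'a::{finite,order} \<Rightarrow> 'a \<Rightarrow> 'b::linorder"
  assumes EL: "EL_labeling lab" and "saturated x y xs" "saturated x y ys" "xs \<noteq> ys"
    "\<not> ord_class.lexordp (labels lab ys) (labels lab xs)"
  shows "\<exists>as p q r bs. ys = as @ p # q # r # bs \<and> \<not> lab p q < lab q r \<and> q \<notin> set xs"
  using assms(2-)
proof (induction ys arbitrary: x xs)
  case (Cons a ys)
  have "x \<noteq> y" using Cons.prems(1-3) by (auto simp: saturated_self)
  then have "x < y" using saturated_le[OF Cons.prems(1)] by simp
  obtain xs' where xs': "xs = x # xs'" "xs' \<noteq> []" "covered_by x (hd xs')" "saturated (hd xs') y xs'"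
    using saturated_ConsE[OF Cons.prems(1) \<open>x < y\<close>] .
  have ys: "a = x" "ys \<noteq> []" "covered_by x (hd ys)" "saturated (hd ys) y ys"
    using saturated_ConsE[OF Cons.prems(2) \<open>x < y\<close>] by auto
  have notin: "x \<notin> set ys"
    using saturated_bounds[OF ys(4), of x] covered_byD[OF ys(3)] by auto
  have lab_xs: "labels lab xs = lab x (hd xs') # labels lab xs'"
    and lab_ys: "labels lab (a # ys) = lab x (hd ys) # labels lab ys"
    using xs' ys by (simp_all add: labels_Cons)
  show ?case
  proof (cases "hd xs' = hd ys")
    case True
    have "\<not> ord_class.lexordp (labels lab ys) (labels lab xs')"
      using Cons.prems(4) True unfolding lab_xs lab_ys by simp
    moreover have "xs' \<noteq> ys" using xs'(1) ys(1) Cons.prems(3) by blast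
    moreover have "saturated (hd ys) y xs'" using xs'(4) True by simp
    ultimately obtain as p q r bs
      where *: "ys = as @ p # q # r # bs" "\<not> lab p q < lab q r" "q \<notin> set xs'"
      using Cons.IH[OF _ ys(4)] by blast
    have "q \<noteq> x" using notin *(1) by auto
    then show ?thesis using * xs'(1) by (intro exI[of _ "a # as"]) auto
  next
    case False
    have "y \<in> set zs" if "saturated w y zs" for w zs
      using that last_in_set[of zs] by (auto simp: saturated_def)
    then have "y \<in> set ys" "y \<in> set xs'" using ys(4) xs'(4) by blast+
    then obtain cs z ds where z: "ys = cs @ z # ds" "z \<in> set xs'" "\<forall>c\<in>set cs. c \<notin> set xs'"
      using split_list_first_prop[of ys "\<lambda>c. c \<in> set xs'"] by metis
    have sat: "saturated x z (x # cs @ [z])"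
      using Cons.prems(2) ys(1) z(1) saturated_append[of x y "x # cs" z ds] by simp
    have hd: "hd (cs @ [z]) = hd ys" using z(1) by (cases cs) auto
    have "hd xs' \<le> z" using saturated_bounds[OF xs'(4) z(2)] by simp
    have "\<not> sorted_wrt (<) (labels lab (x # cs @ [z]))"
    proof
      assume "sorted_wrt (<) (labels lab (x # cs @ [z]))"
      then have "lab x (hd ys) < lab x (hd xs')"
        using EL_first_label_less[OF EL sat _ _ xs'(3) \<open>hd xs' \<le> z\<close>] False unfolding hd by simp
      then show False using Cons.prems(4) unfolding lab_xs lab_ys by simp
    qed
    then obtain as p q r bs where *: "x # cs @ [z] = as @ p # q # r # bs" "\<not> lab p q < lab q r"
      using not_sorted_labels_split by blast
    have "cs = tl (butlast (x # cs @ [z]))" by simp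
    also have "\<dots> = tl (as @ p # q # butlast (r # bs))" unfolding * by (simp add: butlast_append)
    \<comment> \<open>The middle element of the descent is neither the first entry \<open>x\<close>
      nor the last entry \<open>z\<close>, so it belongs to the stretch that avoids
      \<open>xs\<close>.\<close>
    finally have "q \<in> set cs" by (cases as) auto
    then have "q \<notin> set xs" using z notin xs'(1) by auto
    moreover have "a # ys = (x # cs @ [z]) @ ds" using ys(1) z(1) by simp
    then have "a # ys = as @ p # q # r # bs @ ds" unfolding * by simp
    ultimately show ?thesis using *(2) by blast
  qed
qed (simp add: saturated_def)

text \<open>The two steps through \<open>q\<close> are replaced by the increasing chain from
  \<open>p\<close> to \<open>r\<close>, of whatever length. It differs from them because equal
  labels also count as a descent, so its first label is strictly smaller, and it avoids
  \<open>q\<close> because its first step leaves \<open>p\<close> by another cover.\<close>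

lemma lex_replace_descent:
  fixes lab :: "'a::{finite,order} \<Rightarrow> 'a \<Rightarrow> 'b::linorder"
  assumes EL: "EL_labeling lab" and sat: "saturated x y (as @ p # q # r # bs)"
    and desc: "\<not> lab p q < lab q r"
  obtains zs where "saturated x y zs"
    "ord_class.lexordp (labels lab zs) (labels lab (as @ p # q # r # bs))"
    "set zs \<inter> set (as @ p # q # r # bs) = set (as @ p # q # r # bs) - {q}"
proof -
  have parts: "saturated x p (as @ [p])" "covered_by p q" "covered_by q r" "saturated r y (r # bs)"
    using sat saturated_append[of x y as p "q # r # bs"] by (auto simp: saturated_Cons)
  have "p < q" "q < r" using parts covered_byD by blast+
  then have "p < r" "p \<le> r" "q \<le> r" by auto
  obtain ms where ms: "saturated p r ms" "sorted_wrt (<) (labels lab ms)"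
    by (rule EL_labelingE[OF EL \<open>p \<le> r\<close>]) (rule that)
  obtain ns where ns: "ms = p # ns" "ns \<noteq> []" "covered_by p (hd ns)" "saturated (hd ns) r ns"
    using saturated_ConsE[OF ms(1) \<open>p < r\<close>] .
  have "hd ns \<noteq> q"
  proof
    assume "hd ns = q"
    then have "ms = [p, q, r]" using saturated_covered[OF parts(3)] ns by simp
    then show False using ms(2) desc by simp
  qed
  then have less: "lab p (hd ns) < lab p q"
    using EL_first_label_less[OF EL _ ns(2) _ parts(2) \<open>q \<le> r\<close>] ms ns(1) by simp
  obtain qs where qs: "ns = qs @ [r]"
    using ns(2,4) by (cases ns rule: rev_cases) (auto simp: saturated_def)
  let ?zs = "as @ p # qs @ r # bs"
  have "saturated p y (p # qs @ r # bs)"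
    using ms(1) parts(4) saturated_append[of p y "p # qs" r bs] ns(1) qs by simp
  then have 1: "saturated x y ?zs"
    using parts(1) saturated_append by blast
  have "labels lab (p # qs @ r # bs) = lab p (hd ns) # labels lab (qs @ r # bs)"
    unfolding qs by (cases qs) auto
  then have "labels lab ?zs = labels lab (as @ [p]) @ lab p (hd ns) # labels lab (qs @ r # bs)"
    by (subst labels_append) simp
  moreover have "labels lab (as @ p # q # r # bs) =
      labels lab (as @ [p]) @ lab p q # labels lab (q # r # bs)"
    by (subst labels_append) simp
  ultimately have 2: "ord_class.lexordp (labels lab ?zs) (labels lab (as @ p # q # r # bs))"
    using lexordp_append_left_rightI[OF less] by simp
  have "q \<notin> set ns"
  proof
    assume "q \<in> set ns"
    then have "hd ns \<le> q" using saturated_bounds[OF ns(4)] by blast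
    then show False
      using covered_by_between[OF parts(2), of "hd ns"] covered_byD[OF ns(3)] \<open>hd ns \<noteq> q\<close>
      by (auto simp: less_imp_le)
  qed
  moreover have "q \<notin> set as" "q \<notin> set bs" "p \<noteq> q" "r \<noteq> q"
    using saturated_sorted[OF sat] by (auto simp: sorted_wrt_append)
  ultimately have 3: "set ?zs \<inter> set (as @ p # q # r # bs) = set (as @ p # q # r # bs) - {q}"
    by (auto simp: qs)
  from 1 2 3 show thesis by (rule that)
qed

text \<open>Minimal elements are removed one at a time. This breaks ties arbitrarily between chains
  with the same label sequence; \<open>lex_descent\<close> asks only that the later chain does not
  strictly precede the earlier one.\<close>

lemma finite_linear_extension:
  assumes "finite A" "asymp R" "transp R"
  obtains xs where "distinct xs" "set xs = A" "sorted_wrt (\<lambda>a b. \<not> R b a) xs"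
proof -
  have "\<exists>xs. distinct xs \<and> set xs = A \<and> sorted_wrt (\<lambda>a b. \<not> R b a) xs"
    using assms(1)
  proof (induction A rule: finite_psubset_induct)
    case (psubset A)
    show ?case
    proof (cases "A = {}")
      case False
      have "asymp_on A R" "transp_on A R"
        using assms(2,3) by (blast intro: asymp_on_subset transp_on_subset)+
      then obtain m where m: "m \<in> A" "\<forall>x\<in>A. x \<noteq> m \<longrightarrow> \<not> R x m"
        using Finite_Set.bex_min_element[OF psubset.hyps(1) _ _ False] by blast
      have "A - {m} \<subset> A" using m(1) by blast
      obtain xs where xs: "distinct xs" "set xs = A - {m}" "sorted_wrt (\<lambda>a b. \<not> R b a) xs"
        using psubset.IH[OF \<open>A - {m} \<subset> A\<close>] by (elim exE conjE) (rule that)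
      then have "distinct (m # xs) \<and> set (m # xs) = A \<and> sorted_wrt (\<lambda>a b. \<not> R b a) (m # xs)"
        using m by auto
      then show ?thesis by (rule exI)
    qed simp
  qed
  then show thesis using that by blast
qed

lemma EL_shellable_imp_shellable:
  assumes "EL_shellable TYPE('a::{finite,lattice})"
  shows "shellable TYPE('a)"
proof -
  obtain lab :: "'a \<Rightarrow> 'a \<Rightarrow> nat" where EL: "EL_labeling lab"
    using assms unfolding EL_shellable_def by blast
  obtain l u :: 'a where lu: "\<And>x. l \<le> x" "\<And>x. x \<le> u" using bounded_finite_lattice by blast
  have UNIV: "UNIV = {l..u}" using lu by auto
  have facets: "facets (order_complex TYPE('a)) = set ` {xs. saturated l u xs}"
  proof -
    have iff: "saturated l u xs \<longleftrightarrow> sorted_wrt (<) xs \<and> maxchain_of UNIV (set xs)" for xs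
      using maxchain_list_iff_saturated[OF lu(2)[of l]] unfolding maxchain_list_def UNIV by simp
    have "\<exists>xs. saturated l u xs \<and> set xs = C" if "maxchain_of UNIV C" for C
    proof -
      have "chain_of UNIV C" using that unfolding maxchain_of_iff by blast
      then obtain xs where "sorted_wrt (<) xs" "set xs = C" by (rule chain_of_sorted_list)
      then show ?thesis using that iff by blast
    qed
    then show ?thesis unfolding facets_order_complex using iff by blast
  qed
  define R where "R = (\<lambda>xs ys. ord_class.lexordp (labels lab xs) (labels lab ys))"
  have "finite {xs. saturated l u xs}"
  proof (rule finite_subset)
    show "{xs. saturated l u xs} \<subseteq> {xs. set xs \<subseteq> UNIV \<and> distinct xs}"
      using saturated_sorted by (auto intro: sorted_wrt_less_distinct)
  qed (rule finite_subset_distinct, simp)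
  moreover have "asymp R" unfolding R_def by (auto intro!: asympI dest: lexordp_antisym)
  moreover have "transp R" unfolding R_def by (auto intro!: transpI intro: lexordp_trans)
  ultimately obtain L where L: "distinct L" "set L = {xs. saturated l u xs}"
    and sorted: "sorted_wrt (\<lambda>xs ys. \<not> R ys xs) L"
    by (rule finite_linear_extension)
  define F where "F = map set L"
  have "distinct F"
    using L saturated_sorted sorted_wrt_less_unique unfolding F_def distinct_map inj_on_def by blast
  moreover have "set F = facets (order_complex TYPE('a))"
    unfolding facets F_def using L by simp
  moreover have "\<exists>k<j. F ! i \<inter> F ! j \<subseteq> F ! k \<inter> F ! j \<and> card (F ! k \<inter> F ! j) + 1 = card (F ! j)"
    if ij: "i < j" "j < length F" for i j
  proof -
    have len: "j < length L" "i < length L" using ij by (auto simp: F_def)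
    have "\<not> R (L ! j) (L ! i)" "L ! i \<noteq> L ! j"
      using sorted L(1) ij len by (auto simp: sorted_wrt_iff_nth_less nth_eq_iff_index_eq)
    moreover have sat: "saturated l u (L ! i)" "saturated l u (L ! j)"
      using L(2) len nth_mem by blast+
    ultimately obtain as p q r bs where *: "L ! j = as @ p # q # r # bs"
      "\<not> lab p q < lab q r" "q \<notin> set (L ! i)"
      using lex_descent[OF EL sat] unfolding R_def by blast
    \<comment> \<open>Since \<open>q\<close> is not in \<open>F ! i\<close>, the intersection of
      \<open>F ! i\<close> and \<open>F ! j\<close> lies in \<open>F ! j\<close> without
      \<open>q\<close>, which is exactly what the new chain shares with
      \<open>F ! j\<close>.\<close>
    obtain zs where zs: "saturated l u zs" "R zs (L ! j)"
      "set zs \<inter> set (L ! j) = set (L ! j) - {q}"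
      using lex_replace_descent[OF EL _ *(2)] sat(2) unfolding R_def *(1) by blast
    obtain k where k: "k < length L" "zs = L ! k"
      using L(2) zs(1) by (metis in_set_conv_nth mem_Collect_eq)
    have "\<not> j < k" using sorted zs(2) k len by (auto simp: sorted_wrt_iff_nth_less)
    moreover have "k \<noteq> j" using zs(2) k(2) by (auto simp: R_def lexordp_irreflexive')
    ultimately have "k < j" by simp
    moreover have "q \<in> set (L ! j)" using *(1) by simp
    then have "card (set (L ! j) - {q}) + 1 = card (set (L ! j))"
      by (metis Suc_eq_plus1 card_Suc_Diff1 finite_set)
    ultimately show ?thesis
      using *(3) zs(3) k len by (intro exI[of _ k]) (auto simp: F_def)
  qed
  ultimately show ?thesis unfolding shellable_def shellable_complex_def by blast
qed

section \<open>Labels along a shelling\<close>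

text \<open>
  Replacing an element \<open>v\<close> of \<open>C\<close> with \<open>a \<lessdot> v \<lessdot> b\<close> loses no label, by perspectivity: the label of
  \<open>(a, v)\<close> is the label of the last step of \<open>D\<close> below \<open>b\<close>, and that of \<open>(v, b)\<close> is the label of the
  first step of \<open>D\<close> above \<open>a\<close>.
\<close>

lemma chain_labels_subset_if_adjacent:
  fixes C D :: "'a::{finite,lattice} set"
  assumes J: "join_semidistributive TYPE('a)"
    and C: "maxchain_of UNIV C" and D: "maxchain_of UNIV D"
    and card: "card (D \<inter> C) + 1 = card C"
  shows "chain_labels C \<subseteq> chain_labels D"
proof
  fix k assume "k \<in> chain_labels C"
  then obtain s t where st: "s \<in> C" "t \<in> C" "covered_by s t" "join_label s t k"
    unfolding chain_labels_def by blast
  have chainC: "\<And>x y. x \<in> C \<Longrightarrow> y \<in> C \<Longrightarrow> x \<le> y \<or> y \<le> x"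
    and chainD: "\<And>x y. x \<in> D \<Longrightarrow> y \<in> D \<Longrightarrow> x \<le> y \<or> y \<le> x"
    using C D unfolding maxchain_of_iff chain_of_iff by blast+
  \<comment> \<open>Only one side of the exchange is known: \<open>D\<close> misses a single element
    \<open>v\<close> of \<open>C\<close>, but may contain several others in its place.\<close>
  have "card (C - D) = 1"
    using card by (simp add: card_Diff_subset_Int Int_commute)
  then obtain v where v: "C - D = {v}" by (rule card_1_singletonE)
  then have vC: "v \<in> C" and vD: "v \<notin> D" and CD: "\<And>c. c \<in> C \<Longrightarrow> c \<noteq> v \<Longrightarrow> c \<in> D" by auto
  obtain l u :: 'a where lu: "\<And>x. l \<le> x" "\<And>x. x \<le> u" using bounded_finite_lattice by blast
  have "l \<in> C" "u \<in> C" "l \<in> D" "u \<in> D"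
    using C D lu unfolding maxchain_of_iff by blast+
  \<comment> \<open>Bottom and top lie in every maximal chain, so \<open>v\<close> is neither and
    has neighbours \<open>a\<close> and \<open>b\<close> in \<open>C\<close>, which \<open>D\<close>
    keeps.\<close>
  have "\<not> v \<le> l" "\<not> u \<le> v"
    using vD \<open>l \<in> D\<close> \<open>u \<in> D\<close> lu by (metis order.antisym)+
  obtain a where a: "a \<in> C" "covered_by a v"
  proof -
    obtain a b where ab: "a \<in> C" "b \<in> C" "covered_by a b" "\<not> v \<le> a" "v \<le> b"
      by (rule maxchain_of_cross[OF C, where P = "\<lambda>c. v \<le> c" and a = l and b = v])
         (use \<open>l \<in> C\<close> \<open>\<not> v \<le> l\<close> vC in \<open>auto intro: order_trans\<close>)
    then have "a \<le> v" using chainC[OF ab(1) vC] by blast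
    then have "v = b" using covered_by_between[OF ab(3) _ ab(5)] ab(4) by auto
    then show thesis using that ab by blast
  qed
  obtain b where b: "b \<in> C" "covered_by v b"
  proof -
    obtain a' b where ab: "a' \<in> C" "b \<in> C" "covered_by a' b" "\<not> \<not> a' \<le> v" "\<not> b \<le> v"
      by (rule maxchain_of_cross[OF C, where P = "\<lambda>c. \<not> c \<le> v" and a = v and b = u])
         (use \<open>u \<in> C\<close> \<open>\<not> u \<le> v\<close> vC in \<open>auto intro: order_trans\<close>)
    then have "v \<le> b" using chainC[OF ab(2) vC] by blast
    then have "v = a'" using covered_by_between[OF ab(3) _ \<open>v \<le> b\<close>] ab(4,5) by auto
    then show thesis using that ab by blast
  qed
  have "a < v" "v < b" using a b covered_byD by blast+
  then have abD: "a \<in> D" "b \<in> D" using a b CD by auto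
  obtain w where w: "w \<in> D" "covered_by a w" "w \<le> b"
  proof -
    obtain a' w where aw: "a' \<in> D" "w \<in> D" "covered_by a' w" "\<not> \<not> a' \<le> a" "\<not> w \<le> a"
      by (rule maxchain_of_cross[OF D, where P = "\<lambda>c. \<not> c \<le> a" and a = a and b = b])
         (use abD \<open>a < v\<close> \<open>v < b\<close> in \<open>auto intro: order_trans\<close>)
    then have "a \<le> w" using chainD[OF aw(2) abD(1)] by blast
    then have "a = a'" using covered_by_between[OF aw(3) _ \<open>a \<le> w\<close>] aw(4,5) by auto
    have "w \<le> b"
    proof (rule ccontr)
      assume "\<not> w \<le> b"
      then have "b \<le> w" using chainD[OF aw(2) abD(2)] by blast
      then have "b = a \<or> b = w"
        using covered_by_between[OF aw(3), of b] \<open>a = a'\<close> \<open>a < v\<close> \<open>v < b\<close> by auto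
      then show False using \<open>\<not> w \<le> b\<close> \<open>a < v\<close> \<open>v < b\<close> by auto
    qed
    then show thesis using that aw \<open>a = a'\<close> by blast
  qed
  obtain c where c: "c \<in> D" "covered_by c b" "a \<le> c"
  proof -
    obtain c b' where cb: "c \<in> D" "b' \<in> D" "covered_by c b'" "\<not> b \<le> c" "b \<le> b'"
      by (rule maxchain_of_cross[OF D, where P = "\<lambda>c. b \<le> c" and a = a and b = b])
         (use abD \<open>a < v\<close> \<open>v < b\<close> in \<open>auto intro: order_trans\<close>)
    then have "c \<le> b" using chainD[OF cb(1) abD(2)] by blast
    then have "b = b'" using covered_by_between[OF cb(3) _ cb(5)] cb(4) by auto
    have "a \<le> c"
    proof (rule ccontr)
      assume "\<not> a \<le> c"
      then have "c \<le> a" using chainD[OF cb(1) abD(1)] by blast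
      then have "a = c \<or> a = b"
        using covered_by_between[OF cb(3), of a] \<open>b = b'\<close> \<open>a < v\<close> \<open>v < b\<close> by auto
      then show False using \<open>\<not> a \<le> c\<close> \<open>a < v\<close> \<open>v < b\<close> by auto
    qed
    then show thesis using that cb \<open>b = b'\<close> by blast
  qed
  have sup_join: "z \<le> c'" if "join_label a z i" "covered_by a z" "i \<le> c'" "a \<le> c'" for z i c'
    using join_label_sup[OF that(2,1)] that(3,4) by (metis le_sup_iff)
  consider "s = v" | "t = v" | "s \<noteq> v" "t \<noteq> v" by blast
  then show "k \<in> chain_labels D"
  proof cases
    case 1
    have "t = b"
      using chainC[OF st(2) b(1)] covered_by_between[OF b(2), of t] covered_by_between[OF st(3), of b]
        covered_byD[OF st(3)] \<open>v < b\<close> 1 by (auto simp: less_imp_le)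
    have "\<not> w \<le> a" using covered_byD[OF w(2)] by (simp add: less_le_not_le)
    then obtain i where i: "join_label a w i" by (rule join_label_exists)
    \<comment> \<open>Otherwise \<open>w\<close> would lie between \<open>a\<close> and its cover
      \<open>v\<close> and hence equal \<open>v\<close>, which is not in \<open>D\<close>.\<close>
    have "\<not> w \<le> v"
      using covered_by_between[OF a(2), of w] covered_byD[OF w(2)] w(1) vD by (auto simp: less_imp_le)
    then have "\<not> i \<le> v" using sup_join[OF i w(2)] \<open>a < v\<close> by (auto simp: less_imp_le)
    moreover have "i \<le> b" using join_labelD(1)[OF i] w(3) by (rule order_trans)
    moreover have "\<forall>z<i. z \<le> v"
      using join_labelD(3)[OF i] \<open>a < v\<close> by (meson less_imp_le order_trans)
    ultimately have "join_label v b i" by (simp add: join_label_def)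
    then have "i = k" using join_label_unique[OF J b(2)] st(4) 1 \<open>t = b\<close> by blast
    then show ?thesis using i w abD unfolding chain_labels_def by blast
  next
    case 2
    have "s = a"
      using chainC[OF st(1) a(1)] covered_by_between[OF a(2), of s] covered_by_between[OF st(3), of a]
        covered_byD[OF st(3)] \<open>a < v\<close> 2 by (auto simp: less_imp_le)
    then have k: "join_label a v k" using st(4) 2 by simp
    have "\<not> v \<le> c"
      using covered_by_between[OF b(2), of c] covered_byD[OF c(2)] c(1) vD by (auto simp: less_imp_le)
    then have "\<not> k \<le> c" using sup_join[OF k a(2)] c(3) by blast
    moreover have "k \<le> b" using join_labelD(1)[OF k] \<open>v < b\<close> by simp
    moreover have "\<forall>z<k. z \<le> c"
      using join_labelD(3)[OF k] c(3) by (meson order_trans)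
    ultimately have "join_label c b k" by (simp add: join_label_def)
    then show ?thesis using c abD unfolding chain_labels_def by blast
  next
    case 3
    then show ?thesis using st CD unfolding chain_labels_def by blast
  qed
qed

lemma shellable_imp_full_chain:
  assumes J: "join_semidistributive TYPE('a::{finite,lattice})" and "shellable TYPE('a)"
  shows "\<exists>C :: 'a set. full_chain C"
proof -
  obtain F :: "'a set list" where F: "set F = {C. maxchain_of UNIV C}"
    and shelling: "\<And>i j. i < j \<Longrightarrow> j < length F \<Longrightarrow> \<exists>l<j. F ! i \<inter> F ! j \<subseteq> F ! l \<inter> F ! j \<and>
      card (F ! l \<inter> F ! j) + 1 = card (F ! j)"
    using assms(2) unfolding shellable_def shellable_complex_def facets_order_complex by blast
  have max: "maxchain_of UNIV (F ! j)" if "j < length F" for j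
    using F that nth_mem by blast
  have sub: "chain_labels (F ! j) \<subseteq> chain_labels (F ! 0)" if "j < length F" for j
    using that
  proof (induction j rule: less_induct)
    case (less j)
    show ?case
    proof (cases "j = 0")
      case False
      \<comment> \<open>Comparing with the facet at index 0 suffices: it yields an earlier facet
        adjacent to \<open>F ! j\<close>, and the labels descend by induction.\<close>
      then obtain l where l: "l < j" "card (F ! l \<inter> F ! j) + 1 = card (F ! j)"
        using shelling[of 0 j] less.prems by blast
      then have "chain_labels (F ! j) \<subseteq> chain_labels (F ! l)"
        using chain_labels_subset_if_adjacent[OF J] max less.prems by simp
      also have "\<dots> \<subseteq> chain_labels (F ! 0)" using less l(1) by simp
      finally show ?thesis .
    qed simp
  qed
  have "chain_of UNIV ({} :: 'a set)" by (simp add: chain_of_iff)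
  then have "F \<noteq> []" using F maxchain_of_extend by (metis mem_Collect_eq empty_iff empty_set)
  have "j \<in> chain_labels (F ! 0)" if j: "j \<in> JIrr" for j
  proof -
    obtain p where p: "covered_by p j" "join_label p j j" using JIrr_lower_cover[OF j] .
    \<comment> \<open>The cover below \<open>j\<close> carries the label \<open>j\<close>; any
      maximal chain through it is a facet that has \<open>j\<close> among its labels.\<close>
    have "chain_of UNIV {p, j}" using covered_byD[OF p(1)] by (auto simp: chain_of_iff)
    then obtain M where M: "maxchain_of UNIV M" "{p, j} \<subseteq> M" by (rule maxchain_of_extend)
    then have "j \<in> chain_labels M" using p unfolding chain_labels_def by blast
    moreover have "M \<in> set F" using F M(1) by simp
    then obtain i where "i < length F" "M = F ! i" by (auto simp: in_set_conv_nth)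
    ultimately show ?thesis using sub by blast
  qed
  then have "full_chain (F ! 0)"
    unfolding full_chain_def using max \<open>F \<noteq> []\<close> by blast
  then show ?thesis by blast
qed

theorem theorem2:
  assumes "semidistributive TYPE('a::{finite,lattice})"
  shows "(extremal TYPE('a) \<longleftrightarrow> left_modular TYPE('a)) \<and>
         (left_modular TYPE('a) \<longleftrightarrow> EL_shellable TYPE('a)) \<and>
         (EL_shellable TYPE('a) \<longleftrightarrow> shellable TYPE('a))"
proof -
  have "EL_shellable TYPE('a)" if "full_chain C" for C :: "'a set"
    using full_chain_imp_EL_labeling[OF assms that] unfolding EL_shellable_def by blast
  moreover have "\<exists>C :: 'a set. full_chain C" if "shellable TYPE('a)"
    using shellable_imp_full_chain that assms unfolding semidistributive_def by blast
  ultimately show ?thesis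
    using extremal_iff_full_chain[OF assms] left_modular_iff_full_chain[OF assms]
      EL_shellable_imp_shellable[where 'a = 'a] by blast
qed

end
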